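(* Let $\Omega\subset\mathbb{R}^n$ be a bounded, smooth, uniformly (strictly) convex domain with diameter $d=\sup_{x,y\in\Omega}|y-x|$, and let $V:\bar\Omega\to\mathbb{R}$ be a smooth convex function. Let $\tilde V\in C^1([-\tfrac d2,\tfrac d2])$ be an even function which is a modulus of convexity of $V$, i.e. $$\big[\nabla V(y)-\nabla V(x)\big]\cdot\frac{y-x}{|y-x|}\ \ge\ 2\tilde V'\Big(\frac{|y-x|}{2}\Big)\qquad\text{for all }x\neq y\in\Omega.$$ Let $\phi_1>0$ be the first Dirichlet eigenfunction of $-\Delta+V$ on $\Omega$ and $\tilde\phi_1>0$ the first Dirichlet eigenfunction of $-\tilde u''+\tilde V\tilde u=\tilde\lambda\tilde u$ on $(-\tfrac d2,\tfrac d2)$. Then for every $x\neq y$ in $\Omega$, $$\big[\nabla\log\phi_1(y)-\nabla\log\phi_1(x)\big]\cdot\frac{y-x}{|y-x|}\ \le\ 2(\log\tilde\phi_1)'\Big(\frac{|y-x|}{2}\Big).$$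
   Context: The Dirichlet eigenvalue problem $-\Delta u+Vu=\lambda u$ in $\Omega$, $u=0$ on $\partial\Omega$ has eigenvalues $\lambda_1<\lambda_2\le\lambda_3\le\cdots\to\infty$ with eigenfunctions $\phi_j$; the first eigenfunction $\phi_1$ is positive in $\Omega$. The one-dimensional problem $-\tilde u''+\tilde V\tilde u=\tilde\lambda\tilde u$ on $(-\tfrac d2,\tfrac d2)$, $\tilde u(\pm\tfrac d2)=0$, has eigenvalues $\tilde\lambda_1<\tilde\lambda_2\le\cdots$ with eigenfunctions $\tilde\phi_1>0,\tilde\phi_2,\dots$. *)

theory Defs
  imports "HOL-Analysis.Analysis"
begin

definition dderiv :: "('a::euclidean_space \<Rightarrow> real) \<Rightarrow> 'a \<Rightarrow> 'a \<Rightarrow> real" where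
  "dderiv f v x = frechet_derivative f (at x) v"

definition grad :: "('a::euclidean_space \<Rightarrow> real) \<Rightarrow> 'a \<Rightarrow> 'a" where
  "grad f x = (\<Sum>i\<in>Basis. dderiv f i x *\<^sub>R i)"

definition hess :: "('a::euclidean_space \<Rightarrow> real) \<Rightarrow> 'a \<Rightarrow> 'a \<Rightarrow> 'a \<Rightarrow> real" where
  "hess f x v w = dderiv (dderiv f v) w x"

definition lap :: "('a::euclidean_space \<Rightarrow> real) \<Rightarrow> 'a \<Rightarrow> real" where
  "lap f x = (\<Sum>i\<in>Basis. hess f x i i)"

coinductive smooth_on :: "'a::euclidean_space set \<Rightarrow> ('a \<Rightarrow> real) \<Rightarrow> bool" where
  "open S \<Longrightarrow> continuous_on S f \<Longrightarrow> (\<forall>x\<in>S. f differentiable (at x))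
    \<Longrightarrow> (\<forall>i\<in>Basis. smooth_on S (dderiv f i)) \<Longrightarrow> smooth_on S f"

definition C2_on :: "'a::euclidean_space set \<Rightarrow> ('a \<Rightarrow> real) \<Rightarrow> bool" where
  "C2_on S f \<longleftrightarrow> open S \<and> (\<forall>x\<in>S. f differentiable (at x))
     \<and> (\<forall>i\<in>Basis. \<forall>x\<in>S. dderiv f i differentiable (at x))
     \<and> (\<forall>i\<in>Basis. \<forall>j\<in>Basis. continuous_on S (\<lambda>x. hess f x i j))"

text \<open>Bounded smooth uniformly convex domain, described by a global smooth defining
  function rho (Omega = {rho < 0}, grad rho nonzero on {rho = 0}) whose Hessian is
  positive definite on tangent vectors at the boundary (positive second fundamental form).\<close>
definition smooth_unif_convex_domain :: "'a::euclidean_space set \<Rightarrow> bool" where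
  "smooth_unif_convex_domain \<Omega> \<longleftrightarrow> bounded \<Omega> \<and> connected \<Omega> \<and> \<Omega> \<noteq> {} \<and>
     (\<exists>\<rho>. smooth_on UNIV \<rho> \<and> \<Omega> = {x. \<rho> x < 0} \<and>
        (\<forall>x. \<rho> x = 0 \<longrightarrow> grad \<rho> x \<noteq> 0) \<and>
        (\<forall>x v. \<rho> x = 0 \<longrightarrow> v \<noteq> 0 \<longrightarrow> v \<bullet> grad \<rho> x = 0 \<longrightarrow> hess \<rho> x v v > 0))"

definition dirichlet_eigenpair ::
    "'a::euclidean_space set \<Rightarrow> ('a \<Rightarrow> real) \<Rightarrow> real \<Rightarrow> ('a \<Rightarrow> real) \<Rightarrow> bool" where
  "dirichlet_eigenpair \<Omega> V lam u \<longleftrightarrow>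
     C2_on \<Omega> u \<and> continuous_on (closure \<Omega>) u \<and> (\<forall>x\<in>frontier \<Omega>. u x = 0) \<and>
     (\<exists>x\<in>\<Omega>. u x \<noteq> 0) \<and>
     (\<forall>x\<in>\<Omega>. - lap u x + V x * u x = lam * u x)"

definition first_dirichlet_eigenfunction ::
    "'a::euclidean_space set \<Rightarrow> ('a \<Rightarrow> real) \<Rightarrow> ('a \<Rightarrow> real) \<Rightarrow> bool" where
  "first_dirichlet_eigenfunction \<Omega> V u \<longleftrightarrow>
     (\<exists>lam. dirichlet_eigenpair \<Omega> V lam u \<and> (\<forall>x\<in>\<Omega>. u x > 0) \<and>
        (\<forall>mu w. dirichlet_eigenpair \<Omega> V mu w \<longrightarrow> lam \<le> mu))"

end

theory Submission
  imports Defs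
begin

text \<open>
  Write w = ln \<open>\<phi>\<close>. For x, y in \<open>\<Omega>\<close> with midpoint m, half difference v and \<open>\<bar>\<tau>\<bar> \<le> 1\<close>, the claim is
  the infinitesimal form (\<open>\<tau> \<rightarrow> 1\<close>) of the four-point inequality
  \<open>\<phi> x * \<phi> y * f (\<tau> \<bar>v\<bar>)\<^sup>2 \<le> \<phi> (m + \<tau> v) * \<phi> (m - \<tau> v) * f (\<bar>v\<bar>)\<^sup>2\<close> with f the one-dimensional
  ground state. Unlike the two-point function of the gradients, the four-point function involves w
  itself, so its maximum principle uses only second derivatives of \<open>\<phi>\<close>: at an interior maximum,
  \<open>\<Delta>w + \<bar>\<nabla>w\<bar>\<^sup>2 = V - \<lambda>\<close> and the analogous equation for ln f make all gradient terms cancel or have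
  the right sign, both eigenvalues drop out, and the modulus of convexity of V remains.

  Two perturbations make this rigorous. Replacing f by \<open>f (1 + \<kappa> \<alpha>)\<close> makes the inequality strict and
  keeps f positive at the ends of the interval. Replacing \<open>\<phi>\<close> at the two inner points by
  \<open>\<phi> + \<epsilon> \<eta>\<close>, where \<open>\<eta> > 0\<close> is a strict supersolution near the boundary, forces the maximum to be
  attained inside and its inner points to stay in a compact subset as \<open>\<epsilon> \<rightarrow> 0\<close>, so that no boundary
  regularity of \<open>\<phi>\<close> is needed.
\<close>

section \<open>A maximum principle for the four-point function\<close>

text \<open>Gradient \<open>p\<close> and Hessian \<open>H\<close> are explicit data, so that
  logarithms, sums and barriers below are handled by formulas. The Hessian enters only as the
  derivative of \<open>p\<close>.\<close>

definition second_order_on ::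
    "'a::euclidean_space set \<Rightarrow> ('a \<Rightarrow> real) \<Rightarrow> ('a \<Rightarrow> 'a) \<Rightarrow> ('a \<Rightarrow> 'a \<Rightarrow> 'a) \<Rightarrow> bool" where
  "second_order_on S u p H \<longleftrightarrow> open S \<and>
     (\<forall>x\<in>S. (u has_derivative (\<lambda>h. p x \<bullet> h)) (at x) \<and> (p has_derivative H x) (at x))"

definition lin_trace :: "('a::euclidean_space \<Rightarrow> 'a) \<Rightarrow> real" where
  "lin_trace A = (\<Sum>b\<in>Basis. A b \<bullet> b)"

lemma second_order_onD:
  assumes "second_order_on S u p H"
  shows "open S" "\<And>x. x \<in> S \<Longrightarrow> (u has_derivative (\<lambda>h. p x \<bullet> h)) (at x)"
    "\<And>x. x \<in> S \<Longrightarrow> (p has_derivative H x) (at x)"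
  using assms by (auto simp: second_order_on_def)

section \<open>Derivatives along curves and lines, and traces\<close>

lemma has_derivative_along_curve:
  assumes "(u has_derivative (\<lambda>h. p \<bullet> h)) (at (c t))" "(c has_vector_derivative c') (at t)"
  shows "((\<lambda>t. u (c t)) has_real_derivative p \<bullet> c') (at t)"
  using has_derivative_compose[OF assms(2)[unfolded has_vector_derivative_def] assms(1)]
  by (simp add: has_field_derivative_def mult_commute_abs)

lemma has_vector_derivative_line:
  fixes a b :: "'a::real_normed_vector"
  shows "((\<lambda>h. a + h *\<^sub>R b) has_vector_derivative b) (at t)"
  by (auto intro!: derivative_eq_intros)

lemma has_derivative_along_line:
  assumes "(u has_derivative (\<lambda>h. p \<bullet> h)) (at (a + t *\<^sub>R b))"
  shows "((\<lambda>t. u (a + t *\<^sub>R b)) has_real_derivative p \<bullet> b) (at t)"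
  using has_derivative_along_curve[of u p "\<lambda>t. a + t *\<^sub>R b", OF assms has_vector_derivative_line] .

lemma gradient_along_line:
  fixes p :: "'a::euclidean_space \<Rightarrow> 'a"
  assumes "(p has_derivative H) (at (a + t *\<^sub>R b))"
  shows "((\<lambda>t. p (a + t *\<^sub>R b) \<bullet> b) has_real_derivative H b \<bullet> b) (at t)"
proof -
  have "((\<lambda>x. p x \<bullet> b) has_derivative (\<lambda>h. H h \<bullet> b)) (at (a + t *\<^sub>R b))"
    using has_derivative_inner_left[OF assms] .
  from has_derivative_compose[OF has_vector_derivative_line[of a b t, unfolded has_vector_derivative_def] this]
  show ?thesis
    using has_derivative_linear[OF assms]
    by (simp add: has_field_derivative_def linear_scale mult_commute_abs)
qed

lemma has_real_derivative_norm_line: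
  fixes v c :: "'a::euclidean_space"
  assumes "v \<noteq> 0"
  shows "((\<lambda>h. norm (v + h *\<^sub>R c)) has_real_derivative (v \<bullet> c) / norm v) (at 0)"
proof -
  have eq: "(\<lambda>h. norm (v + h *\<^sub>R c)) = (\<lambda>h. sqrt (v \<bullet> v + 2 * h * (v \<bullet> c) + h\<^sup>2 * (c \<bullet> c)))"
    by (rule ext) (simp add: norm_eq_sqrt_inner inner_add inner_commute power2_eq_square algebra_simps)
  show ?thesis unfolding eq using assms
    by (auto intro!: derivative_eq_intros simp: norm_eq_sqrt_inner divide_simps)
       (meson inner_ge_zero not_less)
qed

text \<open>At the maximum \<open>q1 0 = 0\<close>. If \<open>q2\<close> were positive,
  \<open>q1\<close> would be positive just to the right of 0 and \<open>q\<close> would increase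
  there.\<close>

lemma second_derivative_nonpos_at_max:
  fixes q :: "real \<Rightarrow> real"
  assumes "0 < d" and q: "\<And>h. \<bar>h\<bar> < d \<Longrightarrow> (q has_real_derivative q1 h) (at h)"
    and q1: "(q1 has_real_derivative q2) (at 0)"
    and mx: "\<And>h. \<bar>h\<bar> < d \<Longrightarrow> q h \<le> q 0"
  shows "q2 \<le> 0"
proof (rule ccontr)
  assume "\<not> q2 \<le> 0"
  then obtain e where e: "e > 0" "\<And>h. 0 < h \<Longrightarrow> h < e \<Longrightarrow> q1 0 < q1 h"
    using DERIV_pos_inc_right[OF q1] by auto
  have "q1 0 = 0"
    using DERIV_local_max[OF q[of 0] \<open>0 < d\<close>] mx \<open>0 < d\<close> by auto
  define h where "h = min d e / 2"
  have h: "0 < h" "h < d" "h < e" using \<open>0 < d\<close> \<open>0 < e\<close> by (auto simp: h_def)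
  have "q 0 < q h"
  proof (rule DERIV_pos_imp_increasing_open[OF h(1)])
    fix x assume "0 < x" "x < h"
    then show "\<exists>y. DERIV q x :> y \<and> 0 < y"
      using q[of x] e(2)[of x] \<open>q1 0 = 0\<close> h by auto
  next
    show "continuous_on {0..h} q"
      using h by (intro continuous_at_imp_continuous_on ballI DERIV_isCont[OF q]) auto
  qed
  then show False using mx[of h] h by auto
qed

text \<open>The reflection in the hyperplane orthogonal to \<open>e\<close> maps the standard basis
  to an orthonormal basis, and the trace does not depend on the basis. In the expansion the
  corrections add up to -2 - 2 + 4 = 0 times \<open>A e \<bullet> e\<close>.\<close>

lemma lin_trace_reflection:
  assumes "linear A" and "norm e = 1"
  shows "(\<Sum>b\<in>Basis. A (b - (2 * (b \<bullet> e)) *\<^sub>R e) \<bullet> (b - (2 * (b \<bullet> e)) *\<^sub>R e)) = lin_trace A"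
proof -
  have ee: "e \<bullet> e = 1" using assms(2) by (simp add: norm_eq_1)
  have s1: "(\<Sum>b\<in>Basis. (b \<bullet> e) * (A b \<bullet> e)) = A e \<bullet> e"
  proof -
    have "A e \<bullet> e = A (\<Sum>b\<in>Basis. (e \<bullet> b) *\<^sub>R b) \<bullet> e" by (simp add: euclidean_representation)
    also have "\<dots> = (\<Sum>b\<in>Basis. (e \<bullet> b) * (A b \<bullet> e))"
      by (simp add: linear_sum[OF assms(1)] linear_scale[OF assms(1)] inner_sum_left)
    finally show ?thesis by (simp add: inner_commute)
  qed
  have s2: "(\<Sum>b\<in>Basis. (b \<bullet> e) * (A e \<bullet> b)) = A e \<bullet> e"
    by (subst (2) euclidean_inner) (simp add: inner_commute mult.commute)
  have s3: "(\<Sum>b\<in>Basis. (b \<bullet> e) * (b \<bullet> e)) = 1"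
    using ee by (subst (asm) euclidean_inner) (simp add: inner_commute)
  have "A (b - (2 * (b \<bullet> e)) *\<^sub>R e) \<bullet> (b - (2 * (b \<bullet> e)) *\<^sub>R e)
     = A b \<bullet> b - 2 * ((b \<bullet> e) * (A b \<bullet> e)) - 2 * ((b \<bullet> e) * (A e \<bullet> b)) + 4 * (A e \<bullet> e) * ((b \<bullet> e) * (b \<bullet> e))" for b
    by (simp add: linear_diff[OF assms(1)] linear_scale[OF assms(1)] inner_diff algebra_simps)
  then show ?thesis
    by (simp add: lin_trace_def sum.distrib sum_subtractf sum_distrib_left[symmetric] s1 s2 s3)
qed

text \<open>Logarithm of the quotient of the two sides of the four-point inequality, with
  \<open>g\<close> the logarithm of the one-dimensional function. \<open>w\<close> and
  \<open>w'\<close> are kept apart because only the function at the inner points is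
  perturbed.\<close>

definition four_point ::
    "('a::euclidean_space \<Rightarrow> real) \<Rightarrow> ('a \<Rightarrow> real) \<Rightarrow> (real \<Rightarrow> real) \<Rightarrow> 'a \<Rightarrow> 'a \<Rightarrow> real \<Rightarrow> real" where
  "four_point w w' g m v \<tau> = w (m + v) + w (m - v) - w' (m + \<tau> *\<^sub>R v) - w' (m - \<tau> *\<^sub>R v)
     - 2 * g (norm v) + 2 * g (\<tau> * norm v)"

lemma convex_inner_points:
  fixes m v :: "'a::real_vector"
  assumes "convex S" "m + v \<in> S" "m - v \<in> S" "\<bar>\<tau>\<bar> \<le> 1"
  shows "m + \<tau> *\<^sub>R v \<in> S" "m - \<tau> *\<^sub>R v \<in> S"
proof -
  have "((1 + t) / 2) *\<^sub>R (m + v) + ((1 - t) / 2) *\<^sub>R (m - v) \<in> S" if "\<bar>t\<bar> \<le> 1" for t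
    using that assms by (intro convexD) (auto simp: field_simps)
  moreover have "((1 + t) / 2) *\<^sub>R (m + v) + ((1 - t) / 2) *\<^sub>R (m - v) = m + t *\<^sub>R v" for t
  proof -
    have "((1 + t) / 2) *\<^sub>R (m + v) + ((1 - t) / 2) *\<^sub>R (m - v)
      = ((1 + t) / 2 + (1 - t) / 2) *\<^sub>R m + ((1 + t) / 2 - (1 - t) / 2) *\<^sub>R v"
      by (simp only: scaleR_add_left scaleR_diff_left scaleR_add_right scaleR_diff_right) simp
    moreover have "(1 + t) / 2 + (1 - t) / 2 = 1" "(1 + t) / 2 - (1 - t) / 2 = t" by (simp_all add: field_simps)
    ultimately show ?thesis by simp
  qed
  ultimately have "m + t *\<^sub>R v \<in> S" if "\<bar>t\<bar> \<le> 1" for t using that by metis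
  from this[of \<tau>] this[of "-\<tau>"] show "m + \<tau> *\<^sub>R v \<in> S" "m - \<tau> *\<^sub>R v \<in> S"
    using assms(4) by auto
qed

section \<open>First and second variation at a maximum\<close>

lemma eventually_nhds_0_abs:
  assumes "eventually P (nhds (0::real))"
  obtains d where "d > 0" "\<And>h. \<bar>h\<bar> < d \<Longrightarrow> P h"
  using assms by (auto simp: eventually_nhds_metric dist_real_def)

lemma eventually_curve_in_open:
  fixes c :: "real \<Rightarrow> 'a::topological_space"
  assumes "open S" "isCont c t" "c t \<in> S"
  shows "\<forall>\<^sub>F h in nhds t. c h \<in> S"
  using topological_tendstoD[OF _ assms(1,3)] assms(2)
  by (simp add: isCont_def tendsto_at_iff_tendsto_nhds)

text \<open>The derivative vanishes along the curve of configurations with velocities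
  \<open>a\<close> for \<open>m\<close>, \<open>c\<close> for \<open>v\<close> and \<open>k\<close>
  for \<open>\<tau>\<close>. The curve stays admissible for small times because
  \<open>\<Omega>\<close> is open, \<open>v \<noteq> 0\<close> and
  \<open>\<bar>\<tau>\<bar> < 1\<close>.\<close>

lemma four_point_first_order:
  fixes \<Omega> :: "'a::euclidean_space set"
  assumes so: "second_order_on \<Omega> w p H" "second_order_on \<Omega> w' p' H'"
    and g: "\<And>t. \<bar>t\<bar> < R \<Longrightarrow> (g has_real_derivative g1 t) (at t)"
    and cvx: "convex \<Omega>"
    and pts: "m + v \<in> \<Omega>" "m - v \<in> \<Omega>" "v \<noteq> 0" "\<bar>\<tau>\<bar> < 1" and R: "norm v < R"
    and mx: "\<And>m' v' \<tau>'. m' + v' \<in> \<Omega> \<Longrightarrow> m' - v' \<in> \<Omega> \<Longrightarrow> v' \<noteq> 0 \<Longrightarrow> \<bar>\<tau>'\<bar> < 1 \<Longrightarrow>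
      four_point w w' g m' v' \<tau>' \<le> four_point w w' g m v \<tau>"
  shows "p (m + v) \<bullet> (a + c) + p (m - v) \<bullet> (a - c)
     - p' (m + \<tau> *\<^sub>R v) \<bullet> (a + k *\<^sub>R v + \<tau> *\<^sub>R c) - p' (m - \<tau> *\<^sub>R v) \<bullet> (a - k *\<^sub>R v - \<tau> *\<^sub>R c)
     - 2 * (g1 (norm v) * ((v \<bullet> c) / norm v))
     + 2 * (g1 (\<tau> * norm v) * (k * norm v + \<tau> * ((v \<bullet> c) / norm v))) = 0"
    (is "?D = 0")
proof -
  note so1 = second_order_onD[OF so(1)] and so2 = second_order_onD[OF so(2)]
  have inner: "m + \<tau> *\<^sub>R v \<in> \<Omega>" "m - \<tau> *\<^sub>R v \<in> \<Omega>"
    using convex_inner_points[OF cvx pts(1,2)] pts(4) by auto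
  have ts: "\<bar>\<tau> * norm v\<bar> < R"
    using mult_left_le_one_le[of "norm v" "\<bar>\<tau>\<bar>"] pts(4) R by (simp add: abs_mult)
  define x1 where "x1 = (\<lambda>h. (m + v) + h *\<^sub>R (a + c))"
  define x4 where "x4 = (\<lambda>h. (m - v) + h *\<^sub>R (a - c))"
  define x2 where "x2 = (\<lambda>h. (m + h *\<^sub>R a) + (\<tau> + h * k) *\<^sub>R (v + h *\<^sub>R c))"
  define x3 where "x3 = (\<lambda>h. (m + h *\<^sub>R a) - (\<tau> + h * k) *\<^sub>R (v + h *\<^sub>R c))"
  define q where "q = (\<lambda>h. w (x1 h) + w (x4 h) - w' (x2 h) - w' (x3 h)
     - 2 * g (norm (v + h *\<^sub>R c)) + 2 * g ((\<tau> + h * k) * norm (v + h *\<^sub>R c)))"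
  have q_eq: "q h = four_point w w' g (m + h *\<^sub>R a) (v + h *\<^sub>R c) (\<tau> + h * k)" for h
    by (simp add: q_def four_point_def x1_def x2_def x3_def x4_def algebra_simps)
  have v1: "(x1 has_vector_derivative (a + c)) (at 0)" "(x4 has_vector_derivative (a - c)) (at 0)"
    unfolding x1_def x4_def by (rule has_vector_derivative_line)+
  have v2: "(x2 has_vector_derivative (a + k *\<^sub>R v + \<tau> *\<^sub>R c)) (at 0)"
    "(x3 has_vector_derivative (a - k *\<^sub>R v - \<tau> *\<^sub>R c)) (at 0)"
    unfolding x2_def x3_def by (auto intro!: derivative_eq_intros)
  have x0: "x1 0 = m + v" "x4 0 = m - v" "x2 0 = m + \<tau> *\<^sub>R v" "x3 0 = m - \<tau> *\<^sub>R v"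
    by (simp_all add: x1_def x2_def x3_def x4_def)
  have dn: "((\<lambda>h. norm (v + h *\<^sub>R c)) has_real_derivative (v \<bullet> c) / norm v) (at 0)"
    by (rule has_real_derivative_norm_line[OF pts(3)])
  have dt: "((\<lambda>h. (\<tau> + h * k) * norm (v + h *\<^sub>R c)) has_real_derivative
      (k * norm v + \<tau> * ((v \<bullet> c) / norm v))) (at 0)"
    by (auto intro!: derivative_eq_intros dn)
  have dg: "((\<lambda>h. g (norm (v + h *\<^sub>R c))) has_real_derivative g1 (norm v) * ((v \<bullet> c) / norm v)) (at 0)"
    using DERIV_chain2[OF _ dn, of g "g1 (norm v)"] g[of "norm v"] R by simp
  have dg': "((\<lambda>h. g ((\<tau> + h * k) * norm (v + h *\<^sub>R c))) has_real_derivative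
       g1 (\<tau> * norm v) * (k * norm v + \<tau> * ((v \<bullet> c) / norm v))) (at 0)"
    using DERIV_chain2[OF _ dt, of g "g1 (\<tau> * norm v)"] g[OF ts] by simp
  have dw: "((\<lambda>h. w (x1 h)) has_real_derivative p (m + v) \<bullet> (a + c)) (at 0)"
    "((\<lambda>h. w (x4 h)) has_real_derivative p (m - v) \<bullet> (a - c)) (at 0)"
    "((\<lambda>h. w' (x2 h)) has_real_derivative p' (m + \<tau> *\<^sub>R v) \<bullet> (a + k *\<^sub>R v + \<tau> *\<^sub>R c)) (at 0)"
    "((\<lambda>h. w' (x3 h)) has_real_derivative p' (m - \<tau> *\<^sub>R v) \<bullet> (a - k *\<^sub>R v - \<tau> *\<^sub>R c)) (at 0)"
    using so1(2)[OF pts(1)] so1(2)[OF pts(2)] so2(2)[OF inner(1)] so2(2)[OF inner(2)]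
    by (intro has_derivative_along_curve v1 v2; simp add: x0)+
  have "(q has_real_derivative ?D) (at 0)"
    unfolding q_def by (intro DERIV_add DERIV_diff DERIV_cmult dw dg dg')
  moreover
  have "\<forall>\<^sub>F h in nhds 0. x1 h \<in> \<Omega> \<and> x4 h \<in> \<Omega> \<and> v + h *\<^sub>R c \<in> - {0} \<and> \<tau> + h * k \<in> {-1<..<1}"
    by (intro eventually_conj eventually_curve_in_open)
       (use so1(1) pts x0 in \<open>auto intro!: continuous_intros simp: x1_def x4_def\<close>)
  then obtain d where d: "d > 0" "\<And>h. \<bar>h\<bar> < d \<Longrightarrow> x1 h \<in> \<Omega> \<and> x4 h \<in> \<Omega> \<and> v + h *\<^sub>R c \<in> - {0} \<and> \<tau> + h * k \<in> {-1<..<1}"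
    using eventually_nhds_0_abs by blast
  have "q h \<le> q 0" if "\<bar>h\<bar> < d" for h
  proof -
    have "q h \<le> four_point w w' g m v \<tau>"
      unfolding q_eq using d(2)[OF that]
      by (intro mx) (auto simp: x1_def x4_def algebra_simps)
    then show ?thesis by (simp add: q_eq)
  qed
  ultimately show ?thesis using DERIV_local_max[of q ?D 0 d] d(1) by auto
qed

text \<open>The variation moves \<open>m + v\<close> and \<open>m + \<tau> v\<close> by b, and \<open>m - v\<close> and \<open>m - \<tau> v\<close> by the reflection
  of b in the hyperplane orthogonal to v: then \<open>\<bar>v\<bar>\<close> and \<open>\<tau> \<bar>v\<bar>\<close> both change at the rate \<open>b \<bullet> e\<close>,
  and summing over an orthonormal basis gives full Laplacians at all four points.\<close>

lemma four_point_second_order: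
  fixes \<Omega> :: "'a::euclidean_space set"
  assumes so: "second_order_on \<Omega> w p H" "second_order_on \<Omega> w' p' H'"
    and g: "\<And>t. \<bar>t\<bar> < R \<Longrightarrow> (g has_real_derivative g1 t) (at t)"
      "\<And>t. \<bar>t\<bar> < R \<Longrightarrow> (g1 has_real_derivative g2 t) (at t)"
    and cvx: "convex \<Omega>"
    and pts: "m + v \<in> \<Omega>" "m - v \<in> \<Omega>" "v \<noteq> 0" "\<bar>\<tau>\<bar> < 1" and R: "norm v < R"
    and mx: "\<And>m' v' \<tau>'. m' + v' \<in> \<Omega> \<Longrightarrow> m' - v' \<in> \<Omega> \<Longrightarrow> v' \<noteq> 0 \<Longrightarrow> \<bar>\<tau>'\<bar> < 1 \<Longrightarrow>
      four_point w w' g m' v' \<tau>' \<le> four_point w w' g m v \<tau>"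
    and e: "e = (1 / norm v) *\<^sub>R v" and b': "b' = b - (2 * (b \<bullet> e)) *\<^sub>R e"
  shows "H (m + v) b \<bullet> b + H (m - v) b' \<bullet> b'
     - H' (m + \<tau> *\<^sub>R v) b \<bullet> b - H' (m - \<tau> *\<^sub>R v) b' \<bullet> b'
     - 2 * (g2 (norm v) * (b \<bullet> e)\<^sup>2) + 2 * (g2 (\<tau> * norm v) * (b \<bullet> e)\<^sup>2) \<le> 0"
    (is "?D \<le> 0")
proof -
  note so1 = second_order_onD[OF so(1)] and so2 = second_order_onD[OF so(2)]
  define s \<beta> where "s = norm v" and "\<beta> = b \<bullet> e"
  have s: "s > 0" "s < R" "v = s *\<^sub>R e" "norm e = 1" using pts R by (auto simp: s_def e)
  have inner: "m + \<tau> *\<^sub>R v \<in> \<Omega>" "m - \<tau> *\<^sub>R v \<in> \<Omega>"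
    using convex_inner_points[OF cvx pts(1,2)] pts(4) by auto
  have ts: "\<bar>\<tau> * s\<bar> < s"
    using mult_strict_right_mono[OF pts(4) s(1)] s(1) by (simp add: abs_mult)
  define q where "q = (\<lambda>h. w ((m + v) + h *\<^sub>R b) + w ((m - v) + h *\<^sub>R b')
     - w' ((m + \<tau> *\<^sub>R v) + h *\<^sub>R b) - w' ((m - \<tau> *\<^sub>R v) + h *\<^sub>R b')
     - 2 * g (s + h * \<beta>) + 2 * g (\<tau> * s + h * \<beta>))"
  define q1 where "q1 = (\<lambda>h. p ((m + v) + h *\<^sub>R b) \<bullet> b + p ((m - v) + h *\<^sub>R b') \<bullet> b'
     - p' ((m + \<tau> *\<^sub>R v) + h *\<^sub>R b) \<bullet> b - p' ((m - \<tau> *\<^sub>R v) + h *\<^sub>R b') \<bullet> b'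
     - 2 * (g1 (s + h * \<beta>) * \<beta>) + 2 * (g1 (\<tau> * s + h * \<beta>) * \<beta>))"
  \<comment> \<open>The last condition says
    \<open>\<tau> * s + h * \<beta> > - (s + h * \<beta>)\<close>; the matching upper bound follows
    from \<open>\<tau> * s < s\<close>. Together they keep the varied parameter strictly between -1
    and 1.\<close>
  have "\<forall>\<^sub>F h in nhds 0. (m + v) + h *\<^sub>R b \<in> \<Omega> \<and> (m - v) + h *\<^sub>R b' \<in> \<Omega> \<and>
     (m + \<tau> *\<^sub>R v) + h *\<^sub>R b \<in> \<Omega> \<and> (m - \<tau> *\<^sub>R v) + h *\<^sub>R b' \<in> \<Omega> \<and>
     s + h * \<beta> \<in> {0<..<R} \<and> \<tau> * s + h * \<beta> + (s + h * \<beta>) \<in> {0<..}"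
    by (intro eventually_conj eventually_curve_in_open)
       (use so1(1) pts inner s ts in \<open>auto intro!: continuous_intros\<close>)
  then obtain d where d: "d > 0" "\<And>h. \<bar>h\<bar> < d \<Longrightarrow> (m + v) + h *\<^sub>R b \<in> \<Omega> \<and> (m - v) + h *\<^sub>R b' \<in> \<Omega> \<and>
     (m + \<tau> *\<^sub>R v) + h *\<^sub>R b \<in> \<Omega> \<and> (m - \<tau> *\<^sub>R v) + h *\<^sub>R b' \<in> \<Omega> \<and>
     s + h * \<beta> \<in> {0<..<R} \<and> \<tau> * s + h * \<beta> + (s + h * \<beta>) \<in> {0<..}"
    using eventually_nhds_0_abs by blast
  have dq: "(q has_real_derivative q1 h) (at h)" if h: "\<bar>h\<bar> < d" for h
  proof -
    have "((\<lambda>h. g (s + h * \<beta>)) has_real_derivative g1 (s + h * \<beta>) * \<beta>) (at h)"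
      by (rule DERIV_chain2[OF g(1)]) (use d(2)[OF h] in \<open>auto intro!: derivative_eq_intros\<close>)
    moreover have "((\<lambda>h. g (\<tau> * s + h * \<beta>)) has_real_derivative g1 (\<tau> * s + h * \<beta>) * \<beta>) (at h)"
    proof (rule DERIV_chain2[OF g(1)])
      have "0 < \<tau> * s + h * \<beta> + (s + h * \<beta>)" "s + h * \<beta> < R" "\<tau> * s < s" using d(2)[OF h] ts by auto
      then show "\<bar>\<tau> * s + h * \<beta>\<bar> < R" unfolding abs_less_iff by linarith
    qed (auto intro!: derivative_eq_intros)
    ultimately show ?thesis
      unfolding q_def q1_def using d(2)[OF h]
      by (intro DERIV_add DERIV_diff DERIV_cmult has_derivative_along_line so1(2) so2(2)) auto
  qed
  have dq1: "(q1 has_real_derivative ?D) (at 0)"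
  proof -
    have "((\<lambda>h. g1 (s + h * \<beta>)) has_real_derivative g2 s * \<beta>) (at 0)"
      using g(2)[of s] s by (intro DERIV_chain2[where f=g1 and g="\<lambda>h. s + h * \<beta>"])
        (auto intro!: derivative_eq_intros)
    moreover have "((\<lambda>h. g1 (\<tau> * s + h * \<beta>)) has_real_derivative g2 (\<tau> * s) * \<beta>) (at 0)"
      using g(2)[of "\<tau> * s"] s ts by (intro DERIV_chain2[where f=g1 and g="\<lambda>h. \<tau> * s + h * \<beta>"])
        (auto intro!: derivative_eq_intros)
    ultimately show ?thesis
      unfolding q1_def s_def[symmetric] \<beta>_def[symmetric] power2_eq_square
        mult.assoc[of _ \<beta> \<beta>, symmetric]
      by (intro DERIV_add DERIV_diff DERIV_cmult DERIV_cmult_right gradient_along_line)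
         (simp_all add: so1(3) so2(3) pts inner)
  qed
  have "q h \<le> q 0" if h: "\<bar>h\<bar> < d" for h
  proof -
    \<comment> \<open>The four moved points form a configuration again: the midpoint moves
      orthogonally to \<open>e\<close>, the half difference keeps its direction, and
      \<open>\<tau>'\<close> is the parameter giving the inner radius
      \<open>\<tau> * s + h * \<beta>\<close>.\<close>
    define m' v' \<tau>' where "m' = m + h *\<^sub>R (b - \<beta> *\<^sub>R e)" and "v' = (s + h * \<beta>) *\<^sub>R e"
      and "\<tau>' = (\<tau> * s + h * \<beta>) / (s + h * \<beta>)"
    note dh = d(2)[OF h]
    have sp: "s + h * \<beta> > 0" using dh by auto
    have n: "norm v' = s + h * \<beta>" using sp s(4) by (simp add: v'_def)
    have tv: "\<tau>' *\<^sub>R v' = (\<tau> * s + h * \<beta>) *\<^sub>R e" "\<tau>' * norm v' = \<tau> * s + h * \<beta>"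
      using sp by (simp_all add: n, simp_all add: \<tau>'_def v'_def)
    have 1: "m' + v' = (m + v) + h *\<^sub>R b" "m' - v' = (m - v) + h *\<^sub>R b'"
      "m' + \<tau>' *\<^sub>R v' = (m + \<tau> *\<^sub>R v) + h *\<^sub>R b" "m' - \<tau>' *\<^sub>R v' = (m - \<tau> *\<^sub>R v) + h *\<^sub>R b'"
      unfolding tv unfolding m'_def v'_def s(3) b' \<beta>_def[symmetric]
      by (simp_all add: algebra_simps scaleR_2[symmetric])
    have "\<bar>\<tau>'\<bar> < 1"
    proof -
      have "\<bar>\<tau> * s + h * \<beta>\<bar> < s + h * \<beta>" using dh ts unfolding abs_less_iff by auto
      then show ?thesis using sp by (simp add: \<tau>'_def)
    qed
    moreover have "v' \<noteq> 0" using n sp by auto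
    ultimately have "four_point w w' g m' v' \<tau>' \<le> four_point w w' g m v \<tau>"
      using dh by (intro mx) (auto simp: 1)
    then show ?thesis
      unfolding four_point_def 1 tv(2) unfolding n by (simp add: q_def s_def)
  qed
  from second_derivative_nonpos_at_max[OF d(1) dq dq1 this] show ?thesis by auto
qed

text \<open>For \<open>w = ln u\<close> the quantity \<open>T\<close> is the Laplacian of
  \<open>u\<close> divided by \<open>u\<close>; \<open>T'\<close> and \<open>G\<close> are its
  analogues. Summing the second-order condition over a basis bounds the Laplacians, and the
  first-order conditions give the squared gradients the favourable sign.\<close>

lemma four_point_maximum_principle:
  fixes \<Omega> :: "'a::euclidean_space set"
  assumes so: "second_order_on \<Omega> w p H" "second_order_on \<Omega> w' p' H'"
    and g: "\<And>t. \<bar>t\<bar> < R \<Longrightarrow> (g has_real_derivative g1 t) (at t)"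
      "\<And>t. \<bar>t\<bar> < R \<Longrightarrow> (g1 has_real_derivative g2 t) (at t)"
    and cvx: "convex \<Omega>"
    and pts: "m + v \<in> \<Omega>" "m - v \<in> \<Omega>" "v \<noteq> 0" "\<bar>\<tau>\<bar> < 1" and R: "norm v < R"
    and mx: "\<And>m' v' \<tau>'. m' + v' \<in> \<Omega> \<Longrightarrow> m' - v' \<in> \<Omega> \<Longrightarrow> v' \<noteq> 0 \<Longrightarrow> \<bar>\<tau>'\<bar> < 1 \<Longrightarrow>
      four_point w w' g m' v' \<tau>' \<le> four_point w w' g m v \<tau>"
    and T: "\<And>x. x \<in> \<Omega> \<Longrightarrow> T x = lin_trace (H x) + (norm (p x))\<^sup>2"
      "\<And>x. x \<in> \<Omega> \<Longrightarrow> T' x = lin_trace (H' x) + (norm (p' x))\<^sup>2"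
      "\<And>t. \<bar>t\<bar> < R \<Longrightarrow> G t = g2 t + (g1 t)\<^sup>2"
  shows "T (m + v) + T (m - v) - T' (m + \<tau> *\<^sub>R v) - T' (m - \<tau> *\<^sub>R v)
      - 2 * G (norm v) + 2 * G (\<tau> * norm v) \<le> 0"
proof -
  note so1 = second_order_onD[OF so(1)] and so2 = second_order_onD[OF so(2)]
  have inner: "m + \<tau> *\<^sub>R v \<in> \<Omega>" "m - \<tau> *\<^sub>R v \<in> \<Omega>"
    using convex_inner_points[OF cvx pts(1,2)] pts(4) by auto
  define s e where "s = norm v" and "e = (1 / norm v) *\<^sub>R v"
  have s: "s > 0" "s < R" "v = s *\<^sub>R e" "norm e = 1" using pts R by (auto simp: s_def e_def)
  have ee: "e \<bullet> e = 1" using s(4) by (simp add: norm_eq_1)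
  have "\<bar>\<tau> * s\<bar> = \<bar>\<tau>\<bar> * s" using s(1) by (simp add: abs_mult)
  then have ts: "\<bar>\<tau> * s\<bar> < R"
    using mult_strict_right_mono[OF pts(4) s(1)] s(2) by linarith
  define x1 x2 x3 x4 where "x1 = m + v" and "x2 = m + \<tau> *\<^sub>R v" and "x3 = m - \<tau> *\<^sub>R v" and "x4 = m - v"
  define r where "r = (\<lambda>b. b - (2 * (b \<bullet> e)) *\<^sub>R e)"
  have lin: "linear (H x1)" "linear (H x4)" "linear (H' x2)" "linear (H' x3)"
    unfolding x1_def x2_def x3_def x4_def using so1(3) so2(3) pts(1,2) inner has_derivative_linear by metis+
  have "(\<Sum>b\<in>Basis. H x1 b \<bullet> b + H x4 (r b) \<bullet> r b - H' x2 b \<bullet> b - H' x3 (r b) \<bullet> r b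
     - 2 * (g2 s * (b \<bullet> e)\<^sup>2) + 2 * (g2 (\<tau> * s) * (b \<bullet> e)\<^sup>2)) \<le> 0"
    unfolding x1_def x2_def x3_def x4_def s_def r_def
    by (rule sum_nonpos) (rule four_point_second_order[OF so g cvx pts R mx e_def refl])
  moreover have "(\<Sum>b\<in>Basis. (b \<bullet> e)\<^sup>2) = 1"
    using ee by (subst (asm) euclidean_inner) (simp add: inner_commute power2_eq_square)
  ultimately have tr: "lin_trace (H x1) + lin_trace (H x4) - lin_trace (H' x2) - lin_trace (H' x3) - 2 * g2 s + 2 * g2 (\<tau> * s) \<le> 0"
    using lin_trace_reflection[OF lin(2) s(4)] lin_trace_reflection[OF lin(4) s(4)]
    by (simp add: sum.distrib sum_subtractf sum_distrib_left[symmetric] lin_trace_def r_def)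
  \<comment> \<open>Varying \<open>a\<close> alone equates the sums of the gradients,
    \<open>k\<close> alone fixes the component of the inner difference \<open>D'\<close> along
    \<open>e\<close>, and \<open>c\<close> alone expresses the outer difference \<open>D\<close>
    through \<open>D'\<close>.\<close>
  have fo: "p x1 \<bullet> (a + c) + p x4 \<bullet> (a - c)
     - p' x2 \<bullet> (a + k *\<^sub>R v + \<tau> *\<^sub>R c) - p' x3 \<bullet> (a - k *\<^sub>R v - \<tau> *\<^sub>R c)
     - 2 * (g1 s * (e \<bullet> c)) + 2 * (g1 (\<tau> * s) * (k * s + \<tau> * (e \<bullet> c))) = 0" for a c k
    using four_point_first_order[OF so g(1) cvx pts R mx, of a c k]
    unfolding x1_def x2_def x3_def x4_def s_def e_def by simp
  define P D D' where "P = p x1 + p x4" and "D = p x1 - p x4" and "D' = p' x2 - p' x3"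
  have P: "P = p' x2 + p' x3"
  proof -
    have "(P - (p' x2 + p' x3)) \<bullet> a = 0" for a
      using fo[of a 0 0] by (simp add: P_def algebra_simps inner_add inner_diff)
    then show ?thesis using inner_eq_zero_iff[of "P - (p' x2 + p' x3)"] by simp
  qed
  have De': "D' \<bullet> e = 2 * g1 (\<tau> * s)"
  proof -
    have "s * (D' \<bullet> e) = s * (2 * g1 (\<tau> * s))"
      using fo[of 0 0 1] by (simp add: D'_def s(3) algebra_simps inner_diff)
    then show ?thesis using s(1) by simp
  qed
  have D: "D = \<tau> *\<^sub>R D' + (2 * g1 s - 2 * \<tau> * g1 (\<tau> * s)) *\<^sub>R e"
  proof -
    have "(D - (\<tau> *\<^sub>R D' + (2 * g1 s - 2 * \<tau> * g1 (\<tau> * s)) *\<^sub>R e)) \<bullet> c = 0" for c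
      using fo[of 0 c 0] by (simp add: D_def D'_def algebra_simps inner_add inner_diff)
    then show ?thesis using inner_eq_zero_iff[of "D - (\<tau> *\<^sub>R D' + (2 * g1 s - 2 * \<tau> * g1 (\<tau> * s)) *\<^sub>R e)"] by simp
  qed
  \<comment> \<open>Since \<open>D' \<bullet> e = 2 * g1 (\<tau> * s)\<close>, the bracket is the
    squared length of the part of \<open>D'\<close> orthogonal to \<open>e\<close>. It is
    nonnegative, so the factor \<open>\<tau>\<^sup>2 \<le> 1\<close> can only decrease it.\<close>
  have "D \<bullet> D = \<tau>\<^sup>2 * (D' \<bullet> D' - (2 * g1 (\<tau> * s))\<^sup>2) + (2 * g1 s)\<^sup>2"
    unfolding D inner_add inner_scaleR_left inner_scaleR_right inner_commute[of e D'] De' ee power2_eq_square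
    by (simp add: algebra_simps)
  moreover have "(2 * g1 (\<tau> * s))\<^sup>2 \<le> D' \<bullet> D'"
    using Cauchy_Schwarz_ineq[of D' e] De' ee by simp
  then have "\<tau>\<^sup>2 * (D' \<bullet> D' - (2 * g1 (\<tau> * s))\<^sup>2) \<le> 1 * (D' \<bullet> D' - (2 * g1 (\<tau> * s))\<^sup>2)"
    using pts(4) by (intro mult_right_mono) (auto simp: abs_square_le_1)
  ultimately have DD: "D \<bullet> D - 4 * (g1 s)\<^sup>2 \<le> D' \<bullet> D' - 4 * (g1 (\<tau> * s))\<^sup>2" by (simp add: power_mult_distrib)
  \<comment> \<open>By the parallelogram law the squared gradients split into sums, which agree by
    \<open>P\<close>, and differences, which are compared by \<open>DD\<close>.\<close>
  have par: "2 * ((norm a)\<^sup>2 + (norm b)\<^sup>2) = (a + b) \<bullet> (a + b) + (a - b) \<bullet> (a - b)" for a b :: 'a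
    by (simp add: power2_norm_eq_inner inner_add inner_diff inner_commute)
  have "2 * ((norm (p x1))\<^sup>2 + (norm (p x4))\<^sup>2) - 4 * (g1 s)\<^sup>2
     \<le> 2 * ((norm (p' x2))\<^sup>2 + (norm (p' x3))\<^sup>2) - 4 * (g1 (\<tau> * s))\<^sup>2"
    unfolding par using DD P by (simp add: P_def D_def D'_def)
  then show ?thesis
    using tr T(1)[OF pts(1)] T(1)[OF pts(2)] T(2)[OF inner(1)] T(2)[OF inner(2)] T(3)[OF ts] T(3)[of s] s(1,2)
    unfolding x1_def x2_def x3_def x4_def s_def[symmetric] by simp
qed

section \<open>Calculus of second-order data, and the domain\<close>

lemma grad_inner_Basis: "i \<in> Basis \<Longrightarrow> grad f x \<bullet> i = dderiv f i x"
  by (simp add: grad_def)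

lemma has_derivative_grad:
  assumes "f differentiable (at x)"
  shows "(f has_derivative (\<lambda>h. grad f x \<bullet> h)) (at x)"
proof -
  have D: "(f has_derivative frechet_derivative f (at x)) (at x)"
    using assms frechet_derivative_works by blast
  have "frechet_derivative f (at x) h = grad f x \<bullet> h" for h
  proof -
    have "frechet_derivative f (at x) h = frechet_derivative f (at x) (\<Sum>i\<in>Basis. (h \<bullet> i) *\<^sub>R i)"
      by (simp add: euclidean_representation)
    also have "\<dots> = (\<Sum>i\<in>Basis. (h \<bullet> i) * dderiv f i x)"
      using has_derivative_linear[OF D] by (simp add: linear_sum linear_scale dderiv_def)
    also have "\<dots> = grad f x \<bullet> h"
      by (subst euclidean_inner) (simp add: grad_inner_Basis mult.commute)
    finally show ?thesis .
  qed
  then show ?thesis using D by (metis (no_types, lifting) ext)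
qed

lemma C2_on_second_order:
  assumes "C2_on S f"
  shows "second_order_on S f (grad f) (\<lambda>x. frechet_derivative (grad f) (at x))"
    and "\<And>x. x \<in> S \<Longrightarrow> lin_trace (frechet_derivative (grad f) (at x)) = lap f x"
proof -
  have D: "(grad f has_derivative frechet_derivative (grad f) (at x)) (at x)" if "x \<in> S" for x
  proof -
    have "(\<lambda>x. \<Sum>i\<in>Basis. dderiv f i x *\<^sub>R i) differentiable (at x)"
      using assms that by (intro differentiable_sum differentiable_scaleR ballI) (auto simp: C2_on_def)
    then show ?thesis by (simp add: grad_def[abs_def] frechet_derivative_works)
  qed
  then show "second_order_on S f (grad f) (\<lambda>x. frechet_derivative (grad f) (at x))"
    using assms by (auto simp: second_order_on_def C2_on_def intro!: has_derivative_grad)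
  fix x assume x: "x \<in> S"
  have "frechet_derivative (grad f) (at x) i \<bullet> i = hess f x i i" if "i \<in> Basis" for i
  proof -
    have "((\<lambda>x. grad f x \<bullet> i) has_derivative (\<lambda>h. frechet_derivative (grad f) (at x) h \<bullet> i)) (at x)"
      by (rule has_derivative_inner_left[OF D[OF x]])
    moreover have "(\<lambda>x. grad f x \<bullet> i) = dderiv f i" using that by (simp add: fun_eq_iff grad_inner_Basis)
    ultimately have "(dderiv f i has_derivative (\<lambda>h. frechet_derivative (grad f) (at x) h \<bullet> i)) (at x)" by simp
    from frechet_derivative_at[OF this] show ?thesis
      unfolding hess_def dderiv_def[of "dderiv f i"] by metis
  qed
  then show "lin_trace (frechet_derivative (grad f) (at x)) = lap f x" by (simp add: lin_trace_def lap_def)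
qed

lemma smooth_onD:
  assumes "smooth_on S f"
  shows "open S" "continuous_on S f" "\<And>x. x \<in> S \<Longrightarrow> f differentiable (at x)"
    "\<And>i. i \<in> Basis \<Longrightarrow> smooth_on S (dderiv f i)"
  using assms by (auto elim: smooth_on.cases)

lemma smooth_on_imp_C2_on:
  assumes "smooth_on S f" shows "C2_on S f"
  unfolding C2_on_def hess_def
  using smooth_onD[OF assms] smooth_onD(3)[OF smooth_onD(4)[OF assms]]
    smooth_onD(2)[OF smooth_onD(4)[OF smooth_onD(4)[OF assms]]] by auto

text \<open>The boundary condition of \<open>smooth_unif_convex_domain\<close> ranges over all
  tangent vectors, so \<open>hess\<close> is needed off the basis. There \<open>dderiv f v\<close>
  is the inner product of the gradient with \<open>v\<close>.\<close>

lemma hess_eq_second_derivative: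
  assumes "smooth_on UNIV f"
  shows "hess f x v v = frechet_derivative (grad f) (at x) v \<bullet> v"
proof -
  note so = second_order_onD[OF C2_on_second_order(1)[OF smooth_on_imp_C2_on[OF assms]]]
  have eq: "dderiv f v = (\<lambda>x. grad f x \<bullet> v)"
    using frechet_derivative_at[OF so(2)] by (force simp: dderiv_def fun_eq_iff)
  have "((\<lambda>x. grad f x \<bullet> v) has_derivative (\<lambda>h. frechet_derivative (grad f) (at x) h \<bullet> v)) (at x)"
    by (rule has_derivative_inner_left) (simp add: so(3))
  from frechet_derivative_at[OF this] show ?thesis
    unfolding hess_def eq by (metis dderiv_def)
qed

text \<open>The second part is the identity Delta ln u + |grad ln u|^2 = Delta u / u, which brings
  the eigenvalue equation into the form of \<open>T\<close> in the maximum principle.\<close>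

lemma second_order_on_ln:
  assumes so: "second_order_on S u p H" and pos: "\<And>x. x \<in> S \<Longrightarrow> u x > 0"
  shows "second_order_on S (\<lambda>x. ln (u x)) (\<lambda>x. (1 / u x) *\<^sub>R p x)
      (\<lambda>x h. (1 / u x) *\<^sub>R H x h - ((p x \<bullet> h) / (u x)\<^sup>2) *\<^sub>R p x)" (is ?A)
    and "\<And>x. x \<in> S \<Longrightarrow> lin_trace (\<lambda>h. (1 / u x) *\<^sub>R H x h - ((p x \<bullet> h) / (u x)\<^sup>2) *\<^sub>R p x)
       + (norm ((1 / u x) *\<^sub>R p x))\<^sup>2 = lin_trace (H x) / u x"
proof -
  note D = second_order_onD[OF so]
  show ?A unfolding second_order_on_def
  proof (intro conjI ballI D(1))
    fix x assume x: "x \<in> S"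
    show "((\<lambda>x. ln (u x)) has_derivative (\<lambda>h. ((1 / u x) *\<^sub>R p x) \<bullet> h)) (at x)"
      using has_derivative_ln[OF pos[OF x] D(2)[OF x]] by (simp add: inverse_eq_divide)
    have "((\<lambda>x. inverse (u x) *\<^sub>R p x) has_derivative
       (\<lambda>h. inverse (u x) *\<^sub>R H x h + (- (inverse (u x) * (p x \<bullet> h) * inverse (u x))) *\<^sub>R p x)) (at x)"
      using pos[OF x] by (intro has_derivative_scaleR[OF Deriv.has_derivative_inverse[OF _ D(2)[OF x]] D(3)[OF x]]) simp
    then show "((\<lambda>x. (1 / u x) *\<^sub>R p x) has_derivative
       (\<lambda>h. (1 / u x) *\<^sub>R H x h - ((p x \<bullet> h) / (u x)\<^sup>2) *\<^sub>R p x)) (at x)"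
      by (simp add: divide_inverse power2_eq_square mult_ac)
  qed
  fix x assume x: "x \<in> S"
  have "(norm (p x))\<^sup>2 = (\<Sum>b\<in>Basis. (p x \<bullet> b) * (p x \<bullet> b))"
    unfolding power2_norm_eq_inner by (rule euclidean_inner)
  then show "lin_trace (\<lambda>h. (1 / u x) *\<^sub>R H x h - ((p x \<bullet> h) / (u x)\<^sup>2) *\<^sub>R p x)
       + (norm ((1 / u x) *\<^sub>R p x))\<^sup>2 = lin_trace (H x) / u x"
    by (simp add: lin_trace_def inner_diff_left sum_subtractf sum_divide_distrib power_divide)
qed

lemma second_order_on_add_scaled:
  assumes "second_order_on S u p H" "second_order_on S u' p' H'"
  shows "second_order_on S (\<lambda>x. u x + c * u' x) (\<lambda>x. p x + c *\<^sub>R p' x) (\<lambda>x h. H x h + c *\<^sub>R H' x h)"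
  unfolding second_order_on_def
  using second_order_onD[OF assms(1)] second_order_onD[OF assms(2)]
  by (auto intro!: derivative_eq_intros simp: inner_add_left)

lemma lin_trace_add_scaled: "lin_trace (\<lambda>h. A h + c *\<^sub>R B h) = lin_trace A + c * lin_trace B"
  by (simp add: lin_trace_def inner_add_left sum.distrib sum_distrib_left)

lemma second_order_on_subset: "second_order_on S u p H \<Longrightarrow> open T \<Longrightarrow> T \<subseteq> S \<Longrightarrow> second_order_on T u p H"
  by (auto simp: second_order_on_def)

lemma second_order_on_gaussian:
  fixes A :: real
  assumes so: "second_order_on S \<rho> r K"
  defines "\<eta> \<equiv> \<lambda>x. exp (- A * (\<rho> x)\<^sup>2)"
  defines "L \<equiv> \<lambda>x h. (- 2 * A * \<eta> x) *\<^sub>R (((1 - 2 * A * (\<rho> x)\<^sup>2) * (r x \<bullet> h)) *\<^sub>R r x + \<rho> x *\<^sub>R K x h)"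
  shows "second_order_on S \<eta> (\<lambda>x. (- 2 * A * \<rho> x * \<eta> x) *\<^sub>R r x) L"
    and "lin_trace (L x) = - 2 * A * \<eta> x * ((1 - 2 * A * (\<rho> x)\<^sup>2) * (norm (r x))\<^sup>2 + \<rho> x * lin_trace (K x))"
proof -
  note D = second_order_onD[OF so]
  have E: "(\<eta> has_derivative (\<lambda>h. ((- 2 * A * \<rho> x * \<eta> x) *\<^sub>R r x) \<bullet> h)) (at x)" if x: "x \<in> S" for x
    unfolding \<eta>_def by (auto intro!: derivative_eq_intros D(2)[OF x] simp: fun_eq_iff)
  show "second_order_on S \<eta> (\<lambda>x. (- 2 * A * \<rho> x * \<eta> x) *\<^sub>R r x) L"
    unfolding second_order_on_def
  proof (intro conjI ballI D(1) E)
    fix x assume x: "x \<in> S"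
    show "((\<lambda>x. (- 2 * A * \<rho> x * \<eta> x) *\<^sub>R r x) has_derivative L x) (at x)"
      by (rule derivative_eq_intros E[OF x] D(2)[OF x] D(3)[OF x] refl)+
         (auto simp: L_def fun_eq_iff algebra_simps power2_eq_square)
  qed
  have "(norm (r x))\<^sup>2 = (\<Sum>b\<in>Basis. (r x \<bullet> b) * (r x \<bullet> b))"
    unfolding power2_norm_eq_inner by (rule euclidean_inner)
  then show "lin_trace (L x) = - 2 * A * \<eta> x * ((1 - 2 * A * (\<rho> x)\<^sup>2) * (norm (r x))\<^sup>2 + \<rho> x * lin_trace (K x))"
    unfolding lin_trace_def L_def inner_scaleR_left inner_add_left mult.assoc sum_distrib_left[symmetric] sum.distrib
    by simp
qed

text \<open>The set W of points visible from x is open; its complement is open because a segment that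
  only touches the boundary would be tangent to it, against the positivity of the Hessian.\<close>

lemma sublevel_convex:
  fixes \<rho> :: "'a::euclidean_space \<Rightarrow> real"
  assumes so: "second_order_on UNIV \<rho> r K"
    and conn: "connected {x. \<rho> x < 0}"
    and tang: "\<And>x v. \<rho> x = 0 \<Longrightarrow> v \<noteq> 0 \<Longrightarrow> v \<bullet> r x = 0 \<Longrightarrow> K x v \<bullet> v > 0"
  shows "convex {x. \<rho> x < 0}"
proof -
  note D = second_order_onD[OF so]
  let ?\<Omega> = "{x. \<rho> x < 0}"
  have cont: "continuous_on UNIV \<rho>"
    using D(2) by (intro continuous_at_imp_continuous_on ballI has_derivative_continuous) auto
  then have opn: "open ?\<Omega>" using open_Collect_less[of \<rho> "\<lambda>_. 0"] by (auto intro: continuous_intros)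
  define c where "c = (\<lambda>x y t. x + t *\<^sub>R (y - x) :: 'a)"
  \<comment> \<open>If the segment reached \<open>\<rho> = 0\<close> without crossing,
    \<open>\<rho>\<close> would be maximal there: the first derivative vanishes, so the direction is
    tangential, and the second is nonpositive, against \<open>tang\<close>.\<close>
  have nt: "\<exists>t\<in>{0..1}. \<rho> (c x y t) > 0"
    if xy: "x \<in> ?\<Omega>" "y \<in> ?\<Omega>" and t: "t \<in> {0..1}" "\<rho> (c x y t) \<ge> 0" for x y t
  proof (rule ccontr)
    assume "\<not> ?thesis"
    then have le: "\<And>u. u \<in> {0..1} \<Longrightarrow> \<rho> (c x y u) \<le> 0" by force
    have r0: "\<rho> (c x y t) = 0" using le t by force
    define v z where "v = y - x" and "z = c x y t"
    have "t \<noteq> 0" "t \<noteq> 1" "v \<noteq> 0" using r0 xy by (auto simp: c_def v_def)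
    define d where "d = min t (1 - t)"
    have d: "d > 0" using t \<open>t \<noteq> 0\<close> \<open>t \<noteq> 1\<close> by (auto simp: d_def)
    have mx: "\<rho> (z + h *\<^sub>R v) \<le> \<rho> (z + 0 *\<^sub>R v)" if "\<bar>h\<bar> < d" for h
    proof -
      have "z + h *\<^sub>R v = c x y (t + h)" by (simp add: z_def v_def c_def algebra_simps)
      moreover have "t + h \<in> {0..1}" using that by (auto simp: d_def abs_if split: if_splits)
      ultimately show ?thesis using le r0 by (simp add: z_def)
    qed
    have d1: "((\<lambda>h. \<rho> (z + h *\<^sub>R v)) has_real_derivative r (z + h *\<^sub>R v) \<bullet> v) (at h)" for h
      by (rule has_derivative_along_line) (simp add: D(2))
    have d2: "((\<lambda>h. r (z + h *\<^sub>R v) \<bullet> v) has_real_derivative K z v \<bullet> v) (at 0)"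
      by (rule gradient_along_line) (simp add: D(3))
    have "K z v \<bullet> v \<le> 0"
      by (rule second_derivative_nonpos_at_max[OF d d1 d2 mx])
    moreover have "r (z + 0 *\<^sub>R v) \<bullet> v = 0"
      by (rule DERIV_local_max[OF d1 d]) (use mx in auto)
    ultimately show False
      using tang[of z v] r0 \<open>v \<noteq> 0\<close> by (simp add: z_def inner_commute)
  qed
  have "closed_segment x y \<subseteq> ?\<Omega>" if x: "x \<in> ?\<Omega>" and y: "y \<in> ?\<Omega>" for x y
  proof -
    define W where "W = {y. closed_segment x y \<subseteq> ?\<Omega>}"
    have seg: "closed_segment x y = c x y ` {0..1}" for y
      unfolding closed_segment_image_interval by (auto simp: c_def algebra_simps image_def)
    have "open W"
    proof (subst open_subopen, rule ballI)
      fix y assume "y \<in> W"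
      then obtain e where e: "e > 0" "(\<Union>z\<in>closed_segment x y. ball z e) \<subseteq> ?\<Omega>"
        using compact_subset_open_imp_ball_epsilon_subset[OF compact_segment opn, of x y] W_def by auto
      have "y' \<in> W" if y': "y' \<in> ball y e" for y'
      proof -
        have "c x y' t \<in> ?\<Omega>" if t: "t \<in> {0..1}" for t
        proof -
          have "c x y t - c x y' t = t *\<^sub>R (y - y')" by (simp add: c_def algebra_simps)
          then have "dist (c x y t) (c x y' t) = t * dist y y'" using t by (simp add: dist_norm)
          also have "\<dots> \<le> dist y y'" using t by (intro mult_left_le_one_le) auto
          finally have "c x y' t \<in> ball (c x y t) e" using y' by simp
          then show ?thesis using e(2) t unfolding seg by blast
        qed
        then show ?thesis by (auto simp: W_def seg)
      qed
      then show "\<exists>T. open T \<and> y \<in> T \<and> T \<subseteq> W" using e(1) by (intro exI[of _ "ball y e"]) auto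
    qed
    \<comment> \<open>By \<open>nt\<close> a point of \<open>?\<Omega>\<close> outside
      \<open>W\<close> has a witness \<open>\<rho> (c x y t) > 0\<close>, and strict positivity
      survives small changes of \<open>y\<close>.\<close>
    moreover have "open (?\<Omega> - W)"
    proof (subst open_subopen, rule ballI)
      fix y assume y: "y \<in> ?\<Omega> - W"
      then obtain t0 where "t0 \<in> {0..1}" "\<rho> (c x y t0) \<ge> 0"
        unfolding W_def seg image_subset_iff by (auto simp: not_less)
      then obtain t where t: "t \<in> {0..1}" "\<rho> (c x y t) > 0" using nt[OF x] y by blast
      have "open {y'. 0 < \<rho> (c x y' t)}"
        by (rule open_Collect_less) (auto intro!: continuous_intros continuous_on_compose2[OF cont] simp: c_def)
      moreover have "{y'. 0 < \<rho> (c x y' t)} \<inter> W = {}"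
        using t(1) by (force simp: W_def seg)
      ultimately show "\<exists>T. open T \<and> y \<in> T \<and> T \<subseteq> ?\<Omega> - W"
        using t(2) y opn by (intro exI[of _ "{y'. 0 < \<rho> (c x y' t)} \<inter> ?\<Omega>"]) auto
    qed
    ultimately have "W \<inter> ?\<Omega> = {} \<or> (?\<Omega> - W) \<inter> ?\<Omega> = {}"
      by (intro connectedD[OF conn]) auto
    moreover have "x \<in> W" using x by (simp add: W_def)
    ultimately have "y \<in> W" using x y by blast
    then show ?thesis by (simp add: W_def)
  qed
  then show ?thesis by (auto simp: convex_contains_segment)
qed

lemma smooth_unif_convex_domain_open_convex:
  assumes "smooth_unif_convex_domain \<Omega>"
  shows "open \<Omega>" "convex \<Omega>"
proof -
  obtain \<rho> where r: "smooth_on UNIV \<rho>" "\<Omega> = {x. \<rho> x < 0}" "connected \<Omega>"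
    "\<forall>x v. \<rho> x = 0 \<longrightarrow> v \<noteq> 0 \<longrightarrow> v \<bullet> grad \<rho> x = 0 \<longrightarrow> hess \<rho> x v v > 0"
    using assms unfolding smooth_unif_convex_domain_def by blast
  show "open \<Omega>" unfolding r(2)
    using smooth_onD(2)[OF r(1)] by (intro open_Collect_less) (auto intro: continuous_intros)
  show "convex \<Omega>" unfolding r(2)
  proof (rule sublevel_convex)
    show "second_order_on UNIV \<rho> (grad \<rho>) (\<lambda>x. frechet_derivative (grad \<rho>) (at x))"
      by (intro C2_on_second_order smooth_on_imp_C2_on r(1))
  qed (use r in \<open>auto simp: hess_eq_second_derivative[OF r(1), symmetric]\<close>)
qed

text \<open>On the boundary the Laplacian of \<open>exp (- A \<rho>\<^sup>2)\<close> is \<open>- 2 A \<bar>\<nabla>\<rho>\<bar>\<^sup>2\<close>, so a large A dominates c.\<close>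

lemma boundary_supersolution:
  fixes \<Omega> :: "'a::euclidean_space set"
  assumes dom: "smooth_unif_convex_domain \<Omega>" and c: "continuous_on (closure \<Omega>) c"
  obtains \<eta> q K S where "second_order_on \<Omega> \<eta> q K" "continuous_on (closure \<Omega>) \<eta>"
    "\<And>x. \<eta> x > 0" "continuous_on (closure \<Omega>) S" "\<And>x. x \<in> frontier \<Omega> \<Longrightarrow> S x > 0"
    "\<And>x. x \<in> \<Omega> \<Longrightarrow> S x = c x * \<eta> x - lin_trace (K x)"
proof -
  obtain \<rho> where r: "smooth_on UNIV \<rho>" "\<Omega> = {x. \<rho> x < 0}" "bounded \<Omega>"
    "\<And>x. \<rho> x = 0 \<Longrightarrow> grad \<rho> x \<noteq> 0"
    using dom unfolding smooth_unif_convex_domain_def by blast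
  note C2 = smooth_on_imp_C2_on[OF r(1)]
  have so: "second_order_on \<Omega> \<rho> (grad \<rho>) (\<lambda>x. frechet_derivative (grad \<rho>) (at x))"
    by (rule second_order_on_subset[OF C2_on_second_order(1)[OF C2]])
       (use smooth_unif_convex_domain_open_convex[OF dom] in auto)
  have c\<rho>: "continuous_on UNIV \<rho>" by (rule smooth_onD(2)[OF r(1)])
  have cg: "continuous_on UNIV (grad \<rho>)"
    unfolding grad_def[abs_def] by (intro continuous_intros smooth_onD(2)[OF smooth_onD(4)[OF r(1)]])
  have cl: "continuous_on UNIV (lap \<rho>)"
    using C2 unfolding lap_def[abs_def] by (intro continuous_intros) (auto simp: C2_on_def)
  have fr: "\<rho> x = 0" if "x \<in> frontier \<Omega>" for x
  proof -
    have "closed {x. \<rho> x \<le> 0}" by (intro closed_Collect_le c\<rho> continuous_intros)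
    then have "closure \<Omega> \<subseteq> {x. \<rho> x \<le> 0}" by (intro closure_minimal) (auto simp: r(2))
    moreover have "x \<notin> \<Omega>" "x \<in> closure \<Omega>"
      using that smooth_unif_convex_domain_open_convex(1)[OF dom] by (auto simp: frontier_def interior_open)
    ultimately show ?thesis by (force simp: r(2))
  qed
  have cf: "compact (frontier \<Omega>)" using r(3) by (simp add: compact_frontier_bounded)
  have "continuous_on (frontier \<Omega>) (\<lambda>x. c x / (2 * (norm (grad \<rho> x))\<^sup>2))"
    using fr r(4) by (intro continuous_intros continuous_on_subset[OF c] continuous_on_subset[OF cg])
      (auto simp: frontier_def)
  then have "bounded ((\<lambda>x. c x / (2 * (norm (grad \<rho> x))\<^sup>2)) ` frontier \<Omega>)"
    by (intro compact_imp_bounded compact_continuous_image cf)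
  then obtain B where B: "\<And>x. x \<in> frontier \<Omega> \<Longrightarrow> \<bar>c x / (2 * (norm (grad \<rho> x))\<^sup>2)\<bar> \<le> B"
    by (auto simp: bounded_iff)
  \<comment> \<open>\<open>A\<close> exceeds the bound \<open>B\<close> on the boundary ratio, so
    \<open>c x + 2 * A * (norm (grad \<rho> x))\<^sup>2\<close> is positive on the frontier.\<close>
  define A where "A = B + 1"
  define \<eta> where "\<eta> = (\<lambda>x. exp (- A * (\<rho> x)\<^sup>2))"
  \<comment> \<open>\<open>S\<close> is \<open>c * \<eta>\<close> minus the Laplacian of
    \<open>\<eta>\<close>, written through \<open>\<rho>\<close>, \<open>grad \<rho>\<close> and
    \<open>lap \<rho>\<close> so that it is continuous up to the boundary.\<close>
  define S where "S = (\<lambda>x. c x * \<eta> x + 2 * A * \<eta> x * ((1 - 2 * A * (\<rho> x)\<^sup>2) * (norm (grad \<rho> x))\<^sup>2 + \<rho> x * lap \<rho> x))"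
  define L where "L = (\<lambda>x h. (- 2 * A * \<eta> x) *\<^sub>R (((1 - 2 * A * (\<rho> x)\<^sup>2) * (grad \<rho> x \<bullet> h)) *\<^sub>R grad \<rho> x
        + \<rho> x *\<^sub>R frechet_derivative (grad \<rho>) (at x) h))"
  have g: "second_order_on \<Omega> \<eta> (\<lambda>x. (- 2 * A * \<rho> x * \<eta> x) *\<^sub>R grad \<rho> x) L"
    "lin_trace (L x) = - 2 * A * \<eta> x * ((1 - 2 * A * (\<rho> x)\<^sup>2) * (norm (grad \<rho> x))\<^sup>2
      + \<rho> x * lin_trace (frechet_derivative (grad \<rho>) (at x)))" for x
    using second_order_on_gaussian[OF so, of A] unfolding L_def \<eta>_def by auto
  show thesis
  proof (rule that[OF g(1)])
    show c\<eta>: "continuous_on (closure \<Omega>) \<eta>"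
      unfolding \<eta>_def by (intro continuous_intros continuous_on_subset[OF c\<rho>]) auto
    show "\<eta> x > 0" for x by (simp add: \<eta>_def)
    show "continuous_on (closure \<Omega>) S" unfolding S_def
      by (intro continuous_intros c c\<eta> continuous_on_subset[OF c\<rho>] continuous_on_subset[OF cg]
          continuous_on_subset[OF cl]) auto
    show "S x > 0" if x: "x \<in> frontier \<Omega>" for x
    proof -
      have n: "(norm (grad \<rho> x))\<^sup>2 > 0" using fr[OF x] r(4) by simp
      have "c x / (2 * (norm (grad \<rho> x))\<^sup>2) > - A" using B[OF x] unfolding A_def by linarith
      then have "c x > - A * (2 * (norm (grad \<rho> x))\<^sup>2)" using n by (simp add: field_simps)
      then show ?thesis by (simp add: S_def \<eta>_def fr[OF x])
    qed
    show "S x = c x * \<eta> x - lin_trace (L x)" for x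
      using g(2)[of x] C2_on_second_order(2)[OF C2, of x] by (simp add: S_def)
  qed
qed

section \<open>The one-dimensional ground state and its perturbation\<close>

locale positive_dirichlet_solution =
  fixes R l :: real and \<phi> \<phi>1 V :: "real \<Rightarrow> real"
  assumes R_pos: "R > 0"
    and cont: "continuous_on {-R..R} \<phi>" and boundary: "\<phi> R = 0" "\<phi> (-R) = 0"
    and pos: "\<bar>t\<bar> < R \<Longrightarrow> \<phi> t > 0"
    and deriv: "\<bar>t\<bar> < R \<Longrightarrow> (\<phi> has_real_derivative \<phi>1 t) (at t)"
    and ode: "\<bar>t\<bar> < R \<Longrightarrow> (\<phi>1 has_real_derivative (V t - l) * \<phi> t) (at t)"
    and V_cont: "continuous_on {-R..R} V"
    and V_even: "\<bar>t\<bar> < R \<Longrightarrow> V (-t) = V t"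
begin

lemma bounded_on_interval:
  assumes "continuous_on {-R..R} h"
  obtains B where "B > 0" "\<And>t. \<bar>t\<bar> < R \<Longrightarrow> \<bar>h t\<bar> \<le> (B::real)"
proof -
  have "bounded (h ` {-R..R})"
    by (intro compact_imp_bounded compact_continuous_image assms) auto
  then obtain B where "\<And>t. t \<in> {-R..R} \<Longrightarrow> \<bar>h t\<bar> \<le> B" unfolding bounded_iff by fastforce
  then have "\<bar>h t\<bar> \<le> \<bar>B\<bar> + 1" if "\<bar>t\<bar> < R" for t
    using that by (metis abs_ge_self abs_le_iff add_increasing2 atLeastAtMost_iff less_imp_le minus_le_iff
        order_trans zero_le_one)
  then show thesis using that[of "\<bar>B\<bar> + 1"] by auto
qed

lemma constant_of_deriv_zero:
  assumes "\<And>t. \<bar>t\<bar> < R \<Longrightarrow> (h has_real_derivative 0) (at t)" "\<bar>t\<bar> < R"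
  shows "h t = (h 0 :: real)"
proof -
  have "\<exists>c. \<forall>x\<in>{-R<..<R}. h x = c"
    by (rule has_field_derivative_zero_constant)
       (auto intro!: has_field_derivative_at_within assms(1))
  then show ?thesis using assms(2) R_pos by (auto simp: abs_less_iff)
qed

lemma has_derivative_reflect:
  assumes "\<And>t. \<bar>t\<bar> < R \<Longrightarrow> (h has_real_derivative h' t) (at t)" "\<bar>t\<bar> < R"
  shows "((\<lambda>t. h (- t)) has_real_derivative - h' (- t)) (at t)"
  using DERIV_chain2[of h "h' (-t)" uminus t "-1" UNIV] assms(1)[of "-t"] assms(2)
    DERIV_minus[OF DERIV_ident, of t UNIV] by simp

text \<open>By the equation the derivative of \<open>\<phi>1\<close> is
  \<open>(V t - l) * \<phi> t\<close>, bounded as a continuous function on the closed interval; the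
  mean value inequality then bounds \<open>\<phi>1\<close>.\<close>

lemma deriv_bounded:
  obtains M where "M > 0" "\<And>t. \<bar>t\<bar> < R \<Longrightarrow> \<bar>\<phi>1 t\<bar> \<le> M"
proof -
  have "continuous_on {-R..R} (\<lambda>t. (V t - l) * \<phi> t)" by (intro continuous_intros cont V_cont)
  then obtain B where B: "B > 0" "\<And>t. \<bar>t\<bar> < R \<Longrightarrow> \<bar>(V t - l) * \<phi> t\<bar> \<le> B"
    using bounded_on_interval by blast
  have "\<bar>\<phi>1 t\<bar> \<le> \<bar>\<phi>1 0\<bar> + B * R" if t: "\<bar>t\<bar> < R" for t
  proof -
    have "norm (\<phi>1 t - \<phi>1 0) \<le> B * norm (t - 0)"
      by (rule field_differentiable_bound[where S = "{-R<..<R}" and f' = "\<lambda>t. (V t - l) * \<phi> t"])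
         (use t R_pos B in \<open>auto intro!: has_field_derivative_at_within ode\<close>)
    moreover have "B * \<bar>t\<bar> \<le> B * R" using B t by (intro mult_left_mono) auto
    ultimately show ?thesis by simp
  qed
  moreover have "\<bar>\<phi>1 0\<bar> + B * R > 0" using B R_pos by (simp add: add_nonneg_pos)
  ultimately show thesis using that by blast
qed

text \<open>The Wronskian W of \<open>\<phi>\<close> and its reflection is constant and tends to 0 at the end points.\<close>

lemma even:
  assumes t: "\<bar>t\<bar> < R" shows "\<phi> (-t) = \<phi> t"
proof -
  define W where "W = (\<lambda>t. \<phi>1 t * \<phi> (-t) + \<phi> t * \<phi>1 (-t))"
  have W: "W t = W 0" if "\<bar>t\<bar> < R" for t
  proof (rule constant_of_deriv_zero[OF _ that])
    fix t assume t: "\<bar>t\<bar> < R"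
    have "(W has_real_derivative ((V t - l) * \<phi> t * \<phi> (-t) + - \<phi>1 (-t) * \<phi>1 t)
        + (\<phi>1 t * \<phi>1 (-t) + - ((V (-t) - l) * \<phi> (-t)) * \<phi> t)) (at t)"
      unfolding W_def
      by (intro DERIV_add DERIV_mult deriv ode has_derivative_reflect[of \<phi> \<phi>1]
          has_derivative_reflect[of \<phi>1 "\<lambda>t. (V t - l) * \<phi> t"] t)
    then show "(W has_real_derivative 0) (at t)"
      using V_even[OF t] by (simp add: algebra_simps)
  qed
  obtain M where M: "M > 0" "\<And>t. \<bar>t\<bar> < R \<Longrightarrow> \<bar>\<phi>1 t\<bar> \<le> M" using deriv_bounded by blast
  \<comment> \<open>Inside the interval the constant \<open>\<bar>W 0\<bar>\<close> is at most
    \<open>M * (\<phi> t + \<phi> (-t))\<close>; this passes to the end point \<open>R\<close>,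
    where the right side is 0.\<close>
  have "\<bar>W 0\<bar> \<le> M * (\<phi> R + \<phi> (-R))"
  proof (rule continuous_ge_on_closure[where S = "{-R<..<R}" and f = "\<lambda>t. M * (\<phi> t + \<phi> (-t))"])
    show "continuous_on (closure {-R<..<R}) (\<lambda>t. M * (\<phi> t + \<phi> (-t)))"
      using R_pos by (auto intro!: continuous_intros cont continuous_on_compose2[OF cont])
    show "R \<in> closure {-R<..<R}" using R_pos by simp
    fix t assume "t \<in> {-R<..<R}"
    then have t: "\<bar>t\<bar> < R" by auto
    have "\<bar>\<phi>1 t * \<phi> (-t)\<bar> \<le> M * \<phi> (-t)" "\<bar>\<phi> t * \<phi>1 (-t)\<bar> \<le> \<phi> t * M"
      unfolding abs_mult using M(2)[of t] M(2)[of "-t"] pos[of t] pos[of "-t"] t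
      by (auto intro!: mult_mono)
    then have "\<bar>W t\<bar> \<le> M * (\<phi> t + \<phi> (-t))" by (simp add: W_def algebra_simps)
    then show "\<bar>W 0\<bar> \<le> M * (\<phi> t + \<phi> (-t))" using W[OF t] by simp
  qed
  then have W0: "W t = 0" if "\<bar>t\<bar> < R" for t using W[OF that] boundary by simp
  \<comment> \<open>A vanishing Wronskian makes this quotient constant, and its value at 0 is
    1.\<close>
  have "\<phi> t / \<phi> (-t) = \<phi> 0 / \<phi> (-0)"
  proof (rule constant_of_deriv_zero[OF _ t])
    fix t assume t: "\<bar>t\<bar> < R"
    have "((\<lambda>t. \<phi> t / \<phi> (-t)) has_real_derivative
        (\<phi>1 t * \<phi> (-t) - \<phi> t * (- \<phi>1 (-t))) / (\<phi> (-t) * \<phi> (-t))) (at t)"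
      by (intro DERIV_divide deriv has_derivative_reflect[of \<phi> \<phi>1] t) (use pos[of "-t"] t in auto)
    then show "((\<lambda>t. \<phi> t / \<phi> (-t)) has_real_derivative 0) (at t)"
      using W0[OF t] by (simp add: W_def)
  qed
  then show ?thesis using pos[of t] pos[of "-t"] pos[of 0] t R_pos by (simp add: field_simps)
qed

lemma antiderivative:
  assumes "\<And>t. \<bar>t\<bar> < R \<Longrightarrow> isCont h t"
  obtains g where "g 0 = 0" "\<And>t. \<bar>t\<bar> < R \<Longrightarrow> (g has_real_derivative h t) (at t)"
proof -
  obtain F where F: "\<And>x. ereal (-R) < ereal x \<Longrightarrow> ereal x < ereal R \<Longrightarrow> (F has_vector_derivative h x) (at x)"
    using einterval_antiderivative[of "ereal (-R)" "ereal R" h] assms R_pos by (auto simp: abs_less_iff)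
  show thesis
  proof (rule that[of "\<lambda>t. F t - F 0"])
    fix t assume "\<bar>t\<bar> < R"
    then have "(F has_real_derivative h t) (at t)"
      using F[of t] by (auto simp: has_real_derivative_iff_has_vector_derivative)
    then show "((\<lambda>t. F t - F 0) has_real_derivative h t) (at t)"
      by (auto intro!: derivative_eq_intros)
  qed simp
qed

text \<open>\<open>\<alpha>\<close> solves \<open>(\<phi>\<^sup>2 \<alpha>')' = \<phi>\<^sup>2\<close>, which is the equation making \<open>f = \<phi> (1 + \<kappa> \<alpha>)\<close> satisfy
  \<open>f'' = (V - l) f + \<kappa> \<phi>\<close>, that is, \<open>f'' / f = V - l + \<kappa> / (1 + \<kappa> \<alpha>)\<close>. The last term is strictly
  decreasing in \<open>\<bar>t\<bar>\<close>.\<close>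

definition is_corrector :: "(real \<Rightarrow> real) \<Rightarrow> (real \<Rightarrow> real) \<Rightarrow> bool" where
  "is_corrector B \<alpha> \<longleftrightarrow> B 0 = 0 \<and> \<alpha> 0 = 0 \<and>
     (\<forall>t. \<bar>t\<bar> < R \<longrightarrow> (B has_real_derivative (\<phi> t)\<^sup>2) (at t)) \<and>
     (\<forall>t. \<bar>t\<bar> < R \<longrightarrow> (\<alpha> has_real_derivative B t / (\<phi> t)\<^sup>2) (at t))"

lemma corrector_exists: obtains B \<alpha> where "is_corrector B \<alpha>"
proof -
  have "isCont (\<lambda>t. (\<phi> t)\<^sup>2) t" if "\<bar>t\<bar> < R" for t
    by (intro continuous_intros DERIV_isCont[OF deriv] that)
  from antiderivative[OF this]
  obtain B where B: "B 0 = 0" "\<And>t. \<bar>t\<bar> < R \<Longrightarrow> (B has_real_derivative (\<phi> t)\<^sup>2) (at t)" by blast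
  have "isCont (\<lambda>t. B t / (\<phi> t)\<^sup>2) t" if "\<bar>t\<bar> < R" for t
    using pos[OF that] by (intro continuous_intros DERIV_isCont[OF deriv] DERIV_isCont[OF B(2)] that) simp
  from antiderivative[OF this]
  obtain \<alpha> where "\<alpha> 0 = 0" "\<And>t. \<bar>t\<bar> < R \<Longrightarrow> (\<alpha> has_real_derivative B t / (\<phi> t)\<^sup>2) (at t)" by blast
  with B that show thesis unfolding is_corrector_def by blast
qed

context
  fixes B \<alpha> assumes corr: "is_corrector B \<alpha>"
begin

lemma corrD: "B 0 = 0" "\<alpha> 0 = 0"
  "\<bar>t\<bar> < R \<Longrightarrow> (B has_real_derivative (\<phi> t)\<^sup>2) (at t)"
  "\<bar>t\<bar> < R \<Longrightarrow> (\<alpha> has_real_derivative B t / (\<phi> t)\<^sup>2) (at t)"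
  using corr by (auto simp: is_corrector_def)

lemma B_strict_mono: "-R < s \<Longrightarrow> s < t \<Longrightarrow> t < R \<Longrightarrow> B s < B t"
proof (rule DERIV_pos_imp_increasing[of s t B])
  fix x assume "-R < s" "t < R" "s \<le> x" "x \<le> t"
  then have x: "\<bar>x\<bar> < R" by auto
  then show "\<exists>y. DERIV B x :> y \<and> y > 0" using corrD(3)[OF x] pos[OF x] by (intro exI[of _ "(\<phi> x)\<^sup>2"]) auto
qed auto

lemma B_odd: assumes "\<bar>t\<bar> < R" shows "B (-t) = - B t"
proof -
  have "B t + B (-t) = B 0 + B (-0)"
  proof (rule constant_of_deriv_zero[OF _ assms])
    fix t assume t: "\<bar>t\<bar> < R"
    have "((\<lambda>t. B t + B (-t)) has_real_derivative (\<phi> t)\<^sup>2 + - (\<phi> (-t))\<^sup>2) (at t)"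
      by (intro DERIV_add corrD has_derivative_reflect[of B "\<lambda>t. (\<phi> t)\<^sup>2"] t)
    then show "((\<lambda>t. B t + B (-t)) has_real_derivative 0) (at t)" using even[OF t] by simp
  qed
  then show ?thesis using corrD(1) by simp
qed

lemma corrector_even: assumes "\<bar>t\<bar> < R" shows "\<alpha> (-t) = \<alpha> t"
proof -
  have "\<alpha> t - \<alpha> (-t) = \<alpha> 0 - \<alpha> (-0)"
  proof (rule constant_of_deriv_zero[OF _ assms])
    fix t assume t: "\<bar>t\<bar> < R"
    have "((\<lambda>t. \<alpha> t - \<alpha> (-t)) has_real_derivative B t / (\<phi> t)\<^sup>2 - - (B (-t) / (\<phi> (-t))\<^sup>2)) (at t)"
      by (intro DERIV_diff corrD has_derivative_reflect[of \<alpha> "\<lambda>t. B t / (\<phi> t)\<^sup>2"] t)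
    then show "((\<lambda>t. \<alpha> t - \<alpha> (-t)) has_real_derivative 0) (at t)" using even[OF t] B_odd[OF t] by simp
  qed
  then show ?thesis by simp
qed

lemma corrector_abs: "\<bar>t\<bar> < R \<Longrightarrow> \<alpha> \<bar>t\<bar> = \<alpha> t"
  using corrector_even[of t] by (auto simp: abs_if)

text \<open>For positive arguments \<open>B > 0\<close>, so \<open>\<alpha>\<close> increases there;
  evenness extends this to absolute values. This is the source of strictness in the four-point
  argument.\<close>

lemma corrector_strict_mono:
  assumes "\<bar>s\<bar> < \<bar>t\<bar>" "\<bar>t\<bar> < R" shows "\<alpha> s < \<alpha> t"
proof -
  have "\<alpha> \<bar>s\<bar> < \<alpha> \<bar>t\<bar>"
  proof (rule DERIV_pos_imp_increasing_open[OF assms(1)])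
    fix x assume x: "\<bar>s\<bar> < x" "x < \<bar>t\<bar>"
    have "B x > 0" using B_strict_mono[of 0 x] x assms corrD(1) by auto
    then show "\<exists>y. DERIV \<alpha> x :> y \<and> y > 0"
      using corrD(4)[of x] pos[of x] x assms by (intro exI[of _ "B x / (\<phi> x)\<^sup>2"]) auto
  next
    show "continuous_on {\<bar>s\<bar>..\<bar>t\<bar>} \<alpha>"
      using assms by (intro continuous_at_imp_continuous_on ballI DERIV_isCont[OF corrD(4)]) auto
  qed
  then show ?thesis using corrector_abs assms by auto
qed

lemma corrector_nonneg: "\<bar>t\<bar> < R \<Longrightarrow> \<alpha> t \<ge> 0"
  using corrector_strict_mono[of 0 t] corrD(2) by (cases "t = 0") auto

section \<open>Bounds for the perturbed ground state\<close>

context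
  fixes \<kappa> :: real assumes \<kappa>: "\<kappa> > 0"
begin

definition "perturbed t = \<phi> t * (1 + \<kappa> * \<alpha> t)"
definition "perturbed1 t = \<phi>1 t * (1 + \<kappa> * \<alpha> t) + \<kappa> * (B t / \<phi> t)"

lemma perturbed_ge: "\<bar>t\<bar> < R \<Longrightarrow> perturbed t \<ge> \<phi> t"
  unfolding perturbed_def using pos[of t] corrector_nonneg[of t] \<kappa> by (simp add: algebra_simps)

lemma perturbed_pos: "\<bar>t\<bar> < R \<Longrightarrow> perturbed t > 0"
  using perturbed_ge[of t] pos[of t] by auto

lemma perturbed_deriv: assumes t: "\<bar>t\<bar> < R" shows "(perturbed has_real_derivative perturbed1 t) (at t)"
proof -
  have "(perturbed has_real_derivative \<phi>1 t * (1 + \<kappa> * \<alpha> t) + (0 + \<kappa> * (B t / (\<phi> t)\<^sup>2)) * \<phi> t) (at t)"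
    unfolding perturbed_def by (intro DERIV_mult DERIV_add DERIV_const DERIV_cmult deriv corrD t)
  then show ?thesis using pos[OF t] by (simp add: perturbed1_def power2_eq_square)
qed

lemma perturbed_ode: assumes t: "\<bar>t\<bar> < R"
  shows "(perturbed1 has_real_derivative (V t - l) * perturbed t + \<kappa> * \<phi> t) (at t)"
proof -
  have "(perturbed1 has_real_derivative ((V t - l) * \<phi> t) * (1 + \<kappa> * \<alpha> t) + (0 + \<kappa> * (B t / (\<phi> t)\<^sup>2)) * \<phi>1 t
      + \<kappa> * (((\<phi> t)\<^sup>2 * \<phi> t - B t * \<phi>1 t) / (\<phi> t * \<phi> t))) (at t)"
    unfolding perturbed1_def using pos[OF t]
    by (intro DERIV_mult DERIV_add DERIV_const DERIV_cmult DERIV_divide deriv ode corrD t) auto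
  moreover have "((V t - l) * \<phi> t) * (1 + \<kappa> * \<alpha> t) + (0 + \<kappa> * (B t / (\<phi> t)\<^sup>2)) * \<phi>1 t
      + \<kappa> * (((\<phi> t)\<^sup>2 * \<phi> t - B t * \<phi>1 t) / (\<phi> t * \<phi> t)) = (V t - l) * perturbed t + \<kappa> * \<phi> t"
    using pos[OF t] by (simp add: perturbed_def field_simps power2_eq_square)
  ultimately show ?thesis by simp
qed

text \<open>The \<open>\<alpha>\<close> terms cancel. The right side increases with
  \<open>t\<close>, hence stays away from 0 near the right end, where it will bound
  \<open>perturbed\<close> from below.\<close>

lemma wronskian: "\<bar>t\<bar> < R \<Longrightarrow> \<phi> t * perturbed1 t - \<phi>1 t * perturbed t = \<kappa> * B t"
  using pos[of t] by (simp add: perturbed_def perturbed1_def field_simps)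

lemma perturbed_even: "\<bar>t\<bar> < R \<Longrightarrow> perturbed (-t) = perturbed t"
  by (simp add: perturbed_def even corrector_even)

lemma perturbed_abs: "\<bar>t\<bar> < R \<Longrightarrow> perturbed \<bar>t\<bar> = perturbed t"
  using perturbed_even[of t] by (auto simp: abs_if)

text \<open>Gronwall argument: the linear equation of \<open>perturbed\<close> has bounded
  coefficients and a bounded source, so the energy \<open>E\<close> grows at most exponentially.
  Evenness later covers negative \<open>t\<close>.\<close>

lemma perturbed_upper: obtains M where "M > 0" "\<And>t. 0 \<le> t \<Longrightarrow> t < R \<Longrightarrow> perturbed t \<le> M \<and> \<bar>perturbed1 t\<bar> \<le> M"
proof -
  have "continuous_on {-R..R} (\<lambda>t. V t - l)" by (intro continuous_intros V_cont)
  then obtain b where b: "b > 0" "\<And>t. \<bar>t\<bar> < R \<Longrightarrow> \<bar>V t - l\<bar> \<le> b" using bounded_on_interval by blast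
  obtain c where c: "c > 0" "\<And>t. \<bar>t\<bar> < R \<Longrightarrow> \<bar>\<phi> t\<bar> \<le> c" using bounded_on_interval[OF cont] by blast
  \<comment> \<open>\<open>1 + b\<close> bounds the factor of the mixed term; a further
    \<open>1\<close> and \<open>(\<kappa> * c)\<^sup>2\<close> come from splitting the source term
    by \<open>2 * x * y \<le> x\<^sup>2 + y\<^sup>2\<close>. The summand 1 in \<open>E\<close>
    absorbs the constant.\<close>
  define C where "C = 2 + b + (\<kappa> * c)\<^sup>2"
  have C0: "C > 0" using b by (simp add: C_def add_pos_nonneg)
  define E where "E = (\<lambda>t. (perturbed t)\<^sup>2 + (perturbed1 t)\<^sup>2 + 1)"
  define E1 where "E1 = (\<lambda>t. 2 * perturbed t * perturbed1 t + 2 * perturbed1 t * ((V t - l) * perturbed t + \<kappa> * \<phi> t))"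
  have E_deriv: "(E has_real_derivative E1 t) (at t)" if t: "\<bar>t\<bar> < R" for t
    unfolding E_def E1_def by (auto intro!: derivative_eq_intros perturbed_deriv[OF t] perturbed_ode[OF t])
  have E1_le: "E1 t \<le> C * E t" if t: "\<bar>t\<bar> < R" for t
  proof -
    have "2 * perturbed t * perturbed1 t * (1 + (V t - l)) \<le> \<bar>2 * perturbed t * perturbed1 t\<bar> * \<bar>1 + (V t - l)\<bar>"
      by (metis abs_ge_self abs_mult)
    also have "\<dots> \<le> ((perturbed t)\<^sup>2 + (perturbed1 t)\<^sup>2) * (1 + b)"
    proof (rule mult_mono)
      show "\<bar>2 * perturbed t * perturbed1 t\<bar> \<le> (perturbed t)\<^sup>2 + (perturbed1 t)\<^sup>2"
        using sum_squares_bound[of "perturbed t" "perturbed1 t"] sum_squares_bound[of "perturbed t" "- perturbed1 t"] by (simp add: abs_le_iff)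
    qed (use b(2)[OF t] in auto)
    finally have 1: "2 * perturbed t * perturbed1 t * (1 + (V t - l)) \<le> ((perturbed t)\<^sup>2 + (perturbed1 t)\<^sup>2) * (1 + b)" .
    have "2 * perturbed1 t * (\<kappa> * \<phi> t) \<le> (perturbed1 t)\<^sup>2 + (\<kappa> * \<phi> t)\<^sup>2" using sum_squares_bound .
    moreover have "(\<kappa> * \<phi> t)\<^sup>2 \<le> (\<kappa> * c)\<^sup>2"
      using c(2)[OF t] pos[OF t] \<kappa> by (intro power_mono mult_mono) auto
    ultimately have "E1 t \<le> ((perturbed t)\<^sup>2 + (perturbed1 t)\<^sup>2) * (1 + b) + (perturbed1 t)\<^sup>2 + (\<kappa> * c)\<^sup>2"
      using 1 by (simp add: E1_def algebra_simps)
    also have "\<dots> \<le> C * E t"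
    proof -
      have "C * E t = (((perturbed t)\<^sup>2 + (perturbed1 t)\<^sup>2) * (1 + b) + (perturbed1 t)\<^sup>2 + (\<kappa> * c)\<^sup>2)
          + ((perturbed t)\<^sup>2 + (\<kappa> * c)\<^sup>2 * ((perturbed t)\<^sup>2 + (perturbed1 t)\<^sup>2) + (2 + b))"
        by (simp add: C_def E_def algebra_simps)
      moreover have "(perturbed t)\<^sup>2 + (\<kappa> * c)\<^sup>2 * ((perturbed t)\<^sup>2 + (perturbed1 t)\<^sup>2) + (2 + b) \<ge> 0" using b by simp
      ultimately show ?thesis by linarith
    qed
    finally show ?thesis .
  qed
  define M where "M = E 0 * exp (C * R)"
  have E_le: "E t \<le> M" if t: "0 \<le> t" "t < R" for t
  proof -
    have "E t * exp (- C * t) \<le> E 0 * exp (- C * 0)"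
    proof (rule DERIV_nonpos_imp_nonincreasing[OF t(1)])
      fix x assume "0 \<le> x" "x \<le> t"
      then have x: "\<bar>x\<bar> < R" using t by auto
      have "((\<lambda>t. E t * exp (- C * t)) has_real_derivative (E1 x - C * E x) * exp (- C * x)) (at x)"
        by (auto intro!: derivative_eq_intros E_deriv[OF x] simp: algebra_simps)
      then show "\<exists>y. ((\<lambda>t. E t * exp (- C * t)) has_real_derivative y) (at x) \<and> y \<le> 0"
        using E1_le[OF x] by (auto intro!: exI mult_nonpos_nonneg)
    qed
    then have "E t \<le> E 0 * exp (C * t)" by (simp add: exp_minus field_simps)
    also have "\<dots> \<le> M" unfolding M_def
      using t C0 by (intro mult_left_mono) (auto simp: E_def)
    finally show ?thesis .
  qed
  have sq: "\<bar>x\<bar> \<le> x\<^sup>2 + 1" for x :: real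
    using sum_squares_bound[of "\<bar>x\<bar>" 1] by simp
  show thesis
  proof (rule that)
    show "M > 0" unfolding M_def by (simp add: E_def add_nonneg_pos)
    fix t assume "0 \<le> t" "t < R"
    then show "perturbed t \<le> M \<and> \<bar>perturbed1 t\<bar> \<le> M"
      using E_le[of t] sq[of "perturbed t"] sq[of "perturbed1 t"] zero_le_power2[of "perturbed t"] zero_le_power2[of "perturbed1 t"]
      unfolding E_def by linarith
  qed
qed

text \<open>On \<open>{0..R/2}\<close> the minimum of \<open>\<phi>\<close> is a lower bound. Beyond
  it \<open>\<phi>\<close> degenerates, but the Wronskian is at least
  \<open>\<kappa> * B (R/2)\<close> and, since \<open>\<phi> \<le> perturbed\<close>, at most a
  constant multiple of \<open>perturbed\<close>.\<close>

lemma perturbed_bounds: obtains c M where "c > 0" "\<And>t. \<bar>t\<bar> < R \<Longrightarrow> c \<le> perturbed t \<and> perturbed t \<le> M"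
proof -
  obtain M where M: "M > 0" "\<And>t. 0 \<le> t \<Longrightarrow> t < R \<Longrightarrow> perturbed t \<le> M \<and> \<bar>perturbed1 t\<bar> \<le> M" using perturbed_upper by blast
  obtain M1 where M1: "M1 > 0" "\<And>t. \<bar>t\<bar> < R \<Longrightarrow> \<bar>\<phi>1 t\<bar> \<le> M1" using deriv_bounded by blast
  obtain t0 where t0: "t0 \<in> {0..R/2}" "\<And>t. t \<in> {0..R/2} \<Longrightarrow> \<phi> t0 \<le> \<phi> t"
    using continuous_attains_inf[of "{0..R/2}" \<phi>] continuous_on_subset[OF cont, of "{0..R/2}"] R_pos by force
  have c0: "\<phi> t0 > 0" using t0 R_pos by (intro pos) auto
  have B0: "B (R/2) > 0" using B_strict_mono[of 0 "R/2"] corrD(1) R_pos by simp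
  define c where "c = min (\<phi> t0) (\<kappa> * B (R/2) / (M + M1))"
  have c: "c > 0" using c0 B0 \<kappa> M(1) M1(1) by (auto simp: c_def)
  have low: "c \<le> perturbed t" if t: "0 \<le> t" "t < R" for t
  proof (cases "t \<le> R/2")
    case True
    then show ?thesis using t0(2)[of t] perturbed_ge[of t] t by (auto simp: c_def)
  next
    case False
    have at: "\<bar>t\<bar> < R" using t by auto
    have "\<kappa> * B (R/2) \<le> \<kappa> * B t" using False t \<kappa> R_pos B_strict_mono[of "R/2" t] by (intro mult_left_mono) auto
    also have "\<dots> = \<phi> t * perturbed1 t - \<phi>1 t * perturbed t" by (rule wronskian[OF at, symmetric])
    also have "\<dots> \<le> perturbed t * M + M1 * perturbed t"
    proof -
      have "\<phi> t * perturbed1 t \<le> perturbed t * M"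
        using M(2)[OF t] perturbed_ge[OF at] pos[OF at] M(1) by (intro order_trans[OF mult_left_mono[of "perturbed1 t" M]] mult_right_mono) auto
      moreover have "(- \<phi>1 t) * perturbed t \<le> M1 * perturbed t"
        using M1(2)[OF at] perturbed_pos[OF at] by (intro mult_right_mono) auto
      ultimately show ?thesis by simp
    qed
    finally have "\<kappa> * B (R/2) \<le> (M + M1) * perturbed t" by (simp add: algebra_simps)
    then have "\<kappa> * B (R/2) / (M + M1) \<le> perturbed t" using M(1) M1(1) by (simp add: field_simps)
    then show ?thesis by (auto simp: c_def)
  qed
  show thesis
  proof (rule that[OF c])
    fix t assume t: "\<bar>t\<bar> < R"
    show "c \<le> perturbed t \<and> perturbed t \<le> M" using low[of "\<bar>t\<bar>"] M(2)[of "\<bar>t\<bar>"] t perturbed_abs[OF t] by auto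
  qed
qed

end
end
end

section \<open>The four-point inequality\<close>

lemma compact_positive_lower_bound:
  fixes g :: "'a::topological_space \<Rightarrow> real"
  assumes "compact K" "continuous_on K g" "\<And>x. x \<in> K \<Longrightarrow> g x > 0"
  obtains c where "c > 0" "\<And>x. x \<in> K \<Longrightarrow> c \<le> g x"
proof (cases "K = {}")
  case True then show thesis using that[of 1] by auto
next
  case False
  then obtain x where "x \<in> K" "\<And>y. y \<in> K \<Longrightarrow> g x \<le> g y"
    using continuous_attains_inf[OF assms(1) _ assms(2)] by blast
  then show thesis using that[of "g x"] assms(3) by auto
qed

lemma compact_superlevel:
  fixes g :: "'a::t2_space \<Rightarrow> real"
  assumes "compact K" "continuous_on K g"
  shows "compact {x \<in> K. c \<le> g x}"
proof -
  have "closed (K \<inter> g -` {c..})"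
    by (rule continuous_closed_preimage[OF assms(2)]) (use assms(1) in \<open>auto intro: compact_imp_closed\<close>)
  moreover have "{x \<in> K. c \<le> g x} = K \<inter> (K \<inter> g -` {c..})" by auto
  ultimately show ?thesis using assms(1) by (metis compact_Int_closed)
qed

text \<open>To be instantiated with \<open>f\<close> the perturbed ground state, \<open>W\<close>
  the one-dimensional potential minus its eigenvalue and
  \<open>N = \<kappa> / (1 + \<kappa> * \<alpha>)\<close>, so that \<open>W + N\<close> is
  \<open>f'' / f\<close>. Strict monotonicity of \<open>N\<close> is the slack that yields the
  contradiction; \<open>modulus\<close> is the modulus of convexity integrated along a
  segment.\<close>

locale four_point_setting =
  fixes \<Omega> :: "'a::euclidean_space set" and \<phi> V :: "'a \<Rightarrow> real" and p H and lam R c M :: real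
    and f f1 W N :: "real \<Rightarrow> real"
  assumes dom: "smooth_unif_convex_domain \<Omega>"
    and V_cont: "continuous_on (closure \<Omega>) V"
    and \<phi>_so: "second_order_on \<Omega> \<phi> p H"
    and \<phi>_eq: "x \<in> \<Omega> \<Longrightarrow> lin_trace (H x) = (V x - lam) * \<phi> x"
    and \<phi>_pos: "x \<in> \<Omega> \<Longrightarrow> \<phi> x > 0"
    and \<phi>_cont: "continuous_on (closure \<Omega>) \<phi>"
    and \<phi>_bdry: "x \<in> frontier \<Omega> \<Longrightarrow> \<phi> x = 0"
    and width: "x \<in> \<Omega> \<Longrightarrow> y \<in> \<Omega> \<Longrightarrow> norm (x - y) / 2 < R"
    and f_deriv: "\<bar>t\<bar> < R \<Longrightarrow> (f has_real_derivative f1 t) (at t)"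
    and f_ode: "\<bar>t\<bar> < R \<Longrightarrow> (f1 has_real_derivative (W t + N t) * f t) (at t)"
    and c_pos: "c > 0" and f_bounds: "\<bar>t\<bar> < R \<Longrightarrow> c \<le> f t \<and> f t \<le> M"
    and f_even: "\<bar>t\<bar> < R \<Longrightarrow> f (-t) = f t"
    and N_cont: "continuous_on {-R<..<R} N"
    and N_mono: "\<bar>s\<bar> < \<bar>t\<bar> \<Longrightarrow> \<bar>t\<bar> < R \<Longrightarrow> N t < N s"
    and modulus: "m + v \<in> \<Omega> \<Longrightarrow> m - v \<in> \<Omega> \<Longrightarrow> \<bar>\<tau>\<bar> \<le> 1 \<Longrightarrow>
      2 * W (norm v) - 2 * W (\<tau> * norm v) \<le> V (m + v) + V (m - v) - V (m + \<tau> *\<^sub>R v) - V (m - \<tau> *\<^sub>R v)"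
begin

text \<open>A configuration \<open>z = (x, y, \<tau>)\<close> has outer points x, y and inner points \<open>inner1 z\<close>, \<open>inner2 z\<close>;
  \<open>quot u\<close> is the exponential of the four-point function with u in place of \<open>\<phi>\<close> at the inner points.\<close>

definition mid :: "'a \<times> 'a \<times> real \<Rightarrow> 'a" where "mid z = (1/2) *\<^sub>R (fst z + fst (snd z))"
definition half :: "'a \<times> 'a \<times> real \<Rightarrow> 'a" where "half z = (1/2) *\<^sub>R (fst z - fst (snd z))"
definition tau :: "'a \<times> 'a \<times> real \<Rightarrow> real" where "tau z = snd (snd z)"
definition inner1 :: "'a \<times> 'a \<times> real \<Rightarrow> 'a" where "inner1 z = mid z + tau z *\<^sub>R half z"
definition inner2 :: "'a \<times> 'a \<times> real \<Rightarrow> 'a" where "inner2 z = mid z - tau z *\<^sub>R half z"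
definition outer_prod :: "'a \<times> 'a \<times> real \<Rightarrow> real" where "outer_prod z = \<phi> (fst z) * \<phi> (fst (snd z))"
definition quot :: "('a \<Rightarrow> real) \<Rightarrow> 'a \<times> 'a \<times> real \<Rightarrow> real" where
  "quot u z = outer_prod z * (f (tau z * norm (half z)))\<^sup>2
     / (u (inner1 z) * u (inner2 z) * (f (norm (half z)))\<^sup>2)"
definition conf :: "('a \<times> 'a \<times> real) set" where "conf = \<Omega> \<times> \<Omega> \<times> {-1..1}"

lemma open_dom: "open \<Omega>" and convex_dom: "convex \<Omega>"
  using smooth_unif_convex_domain_open_convex[OF dom] by auto

lemma compact_closure_dom: "compact (closure \<Omega>)"
  using dom by (simp add: smooth_unif_convex_domain_def)

lemma closure_cases: "x \<in> closure \<Omega> \<Longrightarrow> x \<in> \<Omega> \<or> x \<in> frontier \<Omega>"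
  using open_dom by (auto simp: frontier_def interior_open)

lemma f_pos: "\<bar>t\<bar> < R \<Longrightarrow> f t > 0"
  using f_bounds[of t] c_pos by auto

lemma mid_half: "mid z + half z = fst z" "mid z - half z = fst (snd z)"
  by (simp_all add: mid_def half_def scaleR_add_right scaleR_diff_right flip: scaleR_add_left)

lemma confD:
  assumes "z \<in> conf"
  shows "fst z \<in> \<Omega>" "fst (snd z) \<in> \<Omega>" "\<bar>tau z\<bar> \<le> 1" "inner1 z \<in> \<Omega>" "inner2 z \<in> \<Omega>"
    "norm (half z) < R" "\<bar>tau z * norm (half z)\<bar> \<le> norm (half z)" "\<bar>tau z * norm (half z)\<bar> < R"
proof -
  show 1: "fst z \<in> \<Omega>" "fst (snd z) \<in> \<Omega>" "\<bar>tau z\<bar> \<le> 1"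
    using assms by (auto simp: conf_def tau_def)
  show "inner1 z \<in> \<Omega>" "inner2 z \<in> \<Omega>"
    unfolding inner1_def inner2_def
    using convex_inner_points[OF convex_dom, of "mid z" "half z" "tau z"] 1 by (auto simp: mid_half)
  show 2: "norm (half z) < R" using width[OF 1(1,2)] by (simp add: half_def)
  show "\<bar>tau z * norm (half z)\<bar> \<le> norm (half z)"
    using 1(3) by (simp add: abs_mult mult_left_le_one_le)
  then show "\<bar>tau z * norm (half z)\<bar> < R" using 2 by simp
qed

lemma continuous_coords [continuous_intros]:
  "continuous_on A mid" "continuous_on A half" "continuous_on A tau"
  "continuous_on A inner1" "continuous_on A inner2"
  unfolding mid_def[abs_def] half_def[abs_def] tau_def[abs_def] inner1_def[abs_def] inner2_def[abs_def]
  by (intro continuous_intros)+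

lemma continuous_on_\<phi>: "continuous_on \<Omega> \<phi>"
  by (rule continuous_on_subset[OF \<phi>_cont closure_subset])

lemma continuous_on_f: "continuous_on {-R<..<R} f"
  by (intro continuous_at_imp_continuous_on ballI DERIV_isCont[OF f_deriv]) auto

lemma continuous_on_quot:
  assumes "continuous_on \<Omega> u" "\<And>x. x \<in> \<Omega> \<Longrightarrow> u x > 0"
  shows "continuous_on conf (quot u)"
  unfolding quot_def[abs_def] outer_prod_def[abs_def]
proof (intro continuous_intros continuous_on_compose2[OF continuous_on_\<phi>]
    continuous_on_compose2[OF continuous_on_f] continuous_on_compose2[OF assms(1)])
  show "\<forall>z\<in>conf. u (inner1 z) * u (inner2 z) * (f (norm (half z)))\<^sup>2 \<noteq> 0"
  proof
    fix z assume "z \<in> conf"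
    note z = confD[OF this]
    show "u (inner1 z) * u (inner2 z) * (f (norm (half z)))\<^sup>2 \<noteq> 0"
      using assms(2)[OF z(4)] assms(2)[OF z(5)] f_pos[of "norm (half z)"] z(6) by auto
  qed
qed (use confD in \<open>fastforce simp: abs_less_iff\<close>)+

lemma quot_pos:
  assumes "z \<in> conf" "\<And>x. x \<in> \<Omega> \<Longrightarrow> u x > 0" shows "quot u z > 0"
  using confD[OF assms(1)] assms(2) \<phi>_pos f_pos[of "norm (half z)"] f_pos[of "tau z * norm (half z)"]
  by (auto simp: quot_def outer_prod_def intro!: divide_pos_pos mult_pos_pos zero_less_power)

section \<open>Degenerate configurations and existence of a maximum\<close>

lemma quot_antimono:
  assumes z: "z \<in> conf" and u: "\<And>x. x \<in> \<Omega> \<Longrightarrow> 0 < u x \<and> u x \<le> u' x"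
  shows "quot u' z \<le> quot u z"
proof -
  note c = confD[OF z]
  have "u (inner1 z) * u (inner2 z) \<le> u' (inner1 z) * u' (inner2 z)"
    using u[OF c(4)] u[OF c(5)] by (intro mult_mono) auto
  then show ?thesis unfolding quot_def
    using u[OF c(4)] u[OF c(5)] \<phi>_pos[OF c(1)] \<phi>_pos[OF c(2)] f_pos[of "norm (half z)"] c(6)
    by (intro divide_left_mono mult_right_mono) (auto simp: outer_prod_def intro!: mult_pos_pos)
qed

text \<open>In these cases inner and outer points coincide as unordered pairs, and the arguments of
  \<open>f\<close> agree up to sign. Hence a quotient above 1 for \<open>\<phi>\<close> forces
  \<open>half z \<noteq> 0\<close> and \<open>\<bar>tau z\<bar> < 1\<close>.\<close>

lemma quot_degenerate:
  assumes z: "z \<in> conf" and deg: "half z = 0 \<or> \<bar>tau z\<bar> = 1"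
  shows "quot \<phi> z = 1"
proof -
  note c = confD[OF z]
  have pos: "\<phi> (fst z) > 0" "\<phi> (fst (snd z)) > 0" "f (norm (half z)) > 0"
    using c \<phi>_pos f_pos[of "norm (half z)"] by auto
  have ev: "f (- norm (half z)) = f (norm (half z))" using c(6) by (intro f_even) auto
  consider "half z = 0" | "tau z = 1" | "tau z = -1" using deg by linarith
  then show ?thesis
  proof cases
    case 1
    then show ?thesis using pos mid_half[of z] by (simp add: quot_def outer_prod_def inner1_def inner2_def)
  next
    case 2
    then show ?thesis using pos by (simp add: quot_def outer_prod_def inner1_def inner2_def mid_half)
  next
    case 3
    then show ?thesis using pos ev by (simp add: quot_def outer_prod_def inner1_def inner2_def mid_half)
  qed
qed

text \<open>The numerator, at most \<open>outer_prod z * M\<^sup>2\<close>, exceeds the denominator,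
  at least \<open>(b * c)\<^sup>2\<close>. This keeps the outer points away from the boundary, where
  \<open>\<phi>\<close> vanishes.\<close>

lemma quot_gt_1_outer_prod:
  assumes z: "z \<in> conf" and q: "quot u z > 1"
    and b: "0 < b" "b \<le> u (inner1 z)" "b \<le> u (inner2 z)"
  shows "(b * c / M)\<^sup>2 \<le> outer_prod z"
proof -
  note cz = confD[OF z]
  have M: "M > 0" using f_bounds[of "norm (half z)"] c_pos cz(6) by auto
  have "b * b * c\<^sup>2 \<le> u (inner1 z) * u (inner2 z) * (f (norm (half z)))\<^sup>2"
    using b c_pos f_bounds[of "norm (half z)"] cz(6) by (intro mult_mono power_mono) auto
  also have "\<dots> \<le> outer_prod z * (f (tau z * norm (half z)))\<^sup>2"
  proof -
    have "u (inner1 z) * u (inner2 z) * (f (norm (half z)))\<^sup>2 > 0"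
      using b f_pos[of "norm (half z)"] cz(6) by (intro mult_pos_pos) auto
    then show ?thesis using q by (simp add: quot_def)
  qed
  also have "\<dots> \<le> outer_prod z * M\<^sup>2"
    using f_bounds[OF cz(8)] c_pos \<phi>_pos[OF cz(1)] \<phi>_pos[OF cz(2)]
    by (intro mult_left_mono power_mono) (auto simp: outer_prod_def)
  finally show ?thesis using M by (simp add: power_divide power_mult_distrib divide_le_eq power2_eq_square mult_ac)
qed

text \<open>Taken over the closure to be compact; for \<open>\<gamma> > 0\<close> the outer points
  still lie in \<open>\<Omega>\<close>, because \<open>\<phi>\<close> vanishes on the
  frontier.\<close>

definition superlevel :: "real \<Rightarrow> ('a \<times> 'a \<times> real) set" where
  "superlevel \<gamma> = {z \<in> closure \<Omega> \<times> closure \<Omega> \<times> {-1..1}. \<gamma> \<le> outer_prod z}"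

lemma compact_superlevel_outer: "compact (superlevel \<gamma>)"
  unfolding superlevel_def outer_prod_def[abs_def]
  by (intro compact_superlevel compact_Times compact_closure_dom continuous_intros
      continuous_on_compose2[OF \<phi>_cont]) auto

lemma superlevel_subset_conf: assumes "\<gamma> > 0" shows "superlevel \<gamma> \<subseteq> conf"
proof
  fix z assume z: "z \<in> superlevel \<gamma>"
  then have "outer_prod z > 0" using assms by (auto simp: superlevel_def)
  then have "fst z \<notin> frontier \<Omega>" "fst (snd z) \<notin> frontier \<Omega>" using \<phi>_bdry by (auto simp: outer_prod_def)
  then show "z \<in> conf" using z by (auto simp: superlevel_def conf_def dest: closure_cases)
qed

lemma conf_superlevel: "z \<in> conf \<Longrightarrow> \<gamma> \<le> outer_prod z \<Longrightarrow> z \<in> superlevel \<gamma>"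
  using closure_subset by (auto simp: superlevel_def conf_def)

text \<open>\<open>conf\<close> is not compact, but values above 1 occur only on a compact
  superlevel set of \<open>outer_prod\<close>. The uniform lower bound \<open>b\<close> will come
  from the perturbation \<open>\<epsilon> * \<eta>\<close>.\<close>

lemma quot_attains_max:
  assumes u: "continuous_on \<Omega> u" and b: "b > 0" "\<And>x. x \<in> \<Omega> \<Longrightarrow> b \<le> u x"
    and z0: "z0 \<in> conf" "quot u z0 > 1"
  obtains z where "z \<in> conf" "quot u z \<ge> quot u z0" "\<And>z'. z' \<in> conf \<Longrightarrow> quot u z' \<le> quot u z"
proof -
  define \<gamma> where "\<gamma> = (b * c / M)\<^sup>2"
  have M: "M > 0" using f_bounds[of "norm (half z0)"] c_pos confD[OF z0(1)] by auto
  have \<gamma>: "\<gamma> > 0" using b c_pos M by (simp add: \<gamma>_def)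
  have mem: "z \<in> superlevel \<gamma>" if "z \<in> conf" "quot u z > 1" for z
    using quot_gt_1_outer_prod[OF that b(1)] confD[OF that(1)] b(2) conf_superlevel[OF that(1)] by (simp add: \<gamma>_def)
  have upos: "u x > 0" if "x \<in> \<Omega>" for x using b(1) b(2)[OF that] by linarith
  have "continuous_on (superlevel \<gamma>) (quot u)"
    using continuous_on_quot[OF u upos] superlevel_subset_conf[OF \<gamma>] continuous_on_subset by blast
  moreover have "superlevel \<gamma> \<noteq> {}" using mem[OF z0] by auto
  ultimately obtain z where z: "z \<in> superlevel \<gamma>" "\<And>z'. z' \<in> superlevel \<gamma> \<Longrightarrow> quot u z' \<le> quot u z"
    using continuous_attains_sup[OF compact_superlevel_outer] by blast
  show thesis
  proof (rule that)
    show "z \<in> conf" using z(1) superlevel_subset_conf[OF \<gamma>] by auto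
    show ge: "quot u z \<ge> quot u z0" using z(2) mem[OF z0] by auto
    show "quot u z' \<le> quot u z" if "z' \<in> conf" for z'
      using z(2) mem[OF that] ge z0(2) by (cases "quot u z' > 1") auto
  qed
qed

lemma ln_quot:
  assumes z: "z \<in> conf" and u: "\<And>x. x \<in> \<Omega> \<Longrightarrow> u x > 0"
  shows "ln (quot u z) = four_point (\<lambda>x. ln (\<phi> x)) (\<lambda>x. ln (u x)) (\<lambda>t. ln (f t)) (mid z) (half z) (tau z)"
proof -
  note c = confD[OF z]
  have "f (norm (half z)) > 0" "f (tau z * norm (half z)) > 0" using c f_pos by auto
  then show ?thesis
    using \<phi>_pos[OF c(1)] \<phi>_pos[OF c(2)] u[OF c(4)] u[OF c(5)]
    by (simp add: quot_def outer_prod_def four_point_def mid_half inner1_def[symmetric] inner2_def[symmetric]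
        ln_mult ln_div ln_realpow)
qed

text \<open>The maximum principle is applied with \<open>V - lam\<close> for \<open>\<phi>\<close>,
  \<open>V - lam - \<epsilon> * S / u\<close> for the perturbed function \<open>u\<close> and
  \<open>W + N\<close> for \<open>f\<close>. The eigenvalue cancels, \<open>modulus\<close> removes
  the differences of \<open>V\<close> and \<open>W\<close>, and the terms in \<open>S\<close> and
  \<open>N\<close> remain.\<close>

lemma quot_max_inequality:
  assumes \<eta>: "second_order_on \<Omega> \<eta> q K" "\<And>x. x \<in> \<Omega> \<Longrightarrow> \<eta> x > 0"
    and S: "\<And>x. x \<in> \<Omega> \<Longrightarrow> S x = (V x - lam) * \<eta> x - lin_trace (K x)"
    and \<epsilon>: "\<epsilon> > 0"
    and z: "z \<in> conf" "half z \<noteq> 0" "\<bar>tau z\<bar> < 1"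
    and mx: "\<And>z'. z' \<in> conf \<Longrightarrow> quot (\<lambda>x. \<phi> x + \<epsilon> * \<eta> x) z' \<le> quot (\<lambda>x. \<phi> x + \<epsilon> * \<eta> x) z"
  shows "\<epsilon> * (S (inner1 z) / (\<phi> (inner1 z) + \<epsilon> * \<eta> (inner1 z)) + S (inner2 z) / (\<phi> (inner2 z) + \<epsilon> * \<eta> (inner2 z)))
     + 2 * (N (tau z * norm (half z)) - N (norm (half z))) \<le> 0"
proof -
  define u where "u = (\<lambda>x. \<phi> x + \<epsilon> * \<eta> x)"
  have up: "u x > 0" if "x \<in> \<Omega>" for x
    using \<phi>_pos[OF that] \<eta>(2)[OF that] \<epsilon> by (simp add: u_def add_pos_pos)
  have uso: "second_order_on \<Omega> u (\<lambda>x. p x + \<epsilon> *\<^sub>R q x) (\<lambda>x h. H x h + \<epsilon> *\<^sub>R K x h)"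
    unfolding u_def by (rule second_order_on_add_scaled[OF \<phi>_so \<eta>(1)])
  note l1 = second_order_on_ln[OF \<phi>_so \<phi>_pos] and l2 = second_order_on_ln[OF uso up]
  note cz = confD[OF z(1)]
  have T1: "V x - lam = lin_trace (H x) / \<phi> x" if "x \<in> \<Omega>" for x
    using \<phi>_eq[OF that] \<phi>_pos[OF that] by simp
  \<comment> \<open>The equation of \<open>\<phi>\<close> and the formula for \<open>S\<close> make
    the Laplacian of \<open>u\<close> equal to
    \<open>(V x - lam) * u x - \<epsilon> * S x\<close>.\<close>
  have T2: "V x - lam - \<epsilon> * (S x / u x) = lin_trace (\<lambda>h. H x h + \<epsilon> *\<^sub>R K x h) / u x" if "x \<in> \<Omega>" for x
    using up[OF that] by (simp add: lin_trace_add_scaled \<phi>_eq[OF that] S[OF that] field_simps u_def)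
  have g1: "((\<lambda>t. ln (f t)) has_real_derivative f1 t / f t) (at t)" if "\<bar>t\<bar> < R" for t
    using f_pos[OF that] by (auto intro!: derivative_eq_intros f_deriv[OF that])
  have g2: "((\<lambda>t. f1 t / f t) has_real_derivative (((W t + N t) * f t) * f t - f1 t * f1 t) / (f t * f t)) (at t)"
    if "\<bar>t\<bar> < R" for t
    by (intro DERIV_divide f_ode f_deriv that) (use f_pos[OF that] in auto)
  have G: "W t + N t = (((W t + N t) * f t) * f t - f1 t * f1 t) / (f t * f t) + (f1 t / f t)\<^sup>2" if "\<bar>t\<bar> < R" for t
    using f_pos[OF that] by (simp add: field_simps power2_eq_square)
  have "(V (mid z + half z) - lam) + (V (mid z - half z) - lam)
      - (V (mid z + tau z *\<^sub>R half z) - lam - \<epsilon> * (S (mid z + tau z *\<^sub>R half z) / u (mid z + tau z *\<^sub>R half z)))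
      - (V (mid z - tau z *\<^sub>R half z) - lam - \<epsilon> * (S (mid z - tau z *\<^sub>R half z) / u (mid z - tau z *\<^sub>R half z)))
      - 2 * (W (norm (half z)) + N (norm (half z)))
      + 2 * (W (tau z * norm (half z)) + N (tau z * norm (half z))) \<le> 0"
  proof (rule four_point_maximum_principle[OF l1(1) l2(1) g1 g2 convex_dom, where R = R])
    show "mid z + half z \<in> \<Omega>" "mid z - half z \<in> \<Omega>" using cz by (auto simp: mid_half)
    show "four_point (\<lambda>x. ln (\<phi> x)) (\<lambda>x. ln (u x)) (\<lambda>t. ln (f t)) m' v' \<tau>'
       \<le> four_point (\<lambda>x. ln (\<phi> x)) (\<lambda>x. ln (u x)) (\<lambda>t. ln (f t)) (mid z) (half z) (tau z)"
      if "m' + v' \<in> \<Omega>" "m' - v' \<in> \<Omega>" "\<bar>\<tau>'\<bar> < 1" for m' v' \<tau>'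
    proof -
      define z' where "z' = (m' + v', m' - v', \<tau>')"
      have z': "z' \<in> conf" using that by (auto simp: z'_def conf_def)
      have eq: "mid z' = m'" "half z' = v'" "tau z' = \<tau>'"
        by (simp_all add: z'_def mid_def half_def tau_def flip: scaleR_2)
      have "ln (quot u z') \<le> ln (quot u z)"
        using mx[OF z'] quot_pos[OF z' up] quot_pos[OF z(1) up] by (simp add: u_def)
      then show ?thesis using ln_quot[OF z' up] ln_quot[OF z(1) up] by (simp add: eq)
    qed
  qed (use z cz T1 T2 G l1(2) l2(2) in auto)
  moreover have "2 * W (norm (half z)) - 2 * W (tau z * norm (half z))
     \<le> V (mid z + half z) + V (mid z - half z) - V (mid z + tau z *\<^sub>R half z) - V (mid z - tau z *\<^sub>R half z)"
    by (rule modulus) (use cz in \<open>auto simp: mid_half\<close>)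
  ultimately show ?thesis
    by (simp add: inner1_def inner2_def u_def algebra_simps)
qed

text \<open>The constants down to \<open>c4\<close> are chosen before \<open>\<epsilon>\<close>. For
  small \<open>\<epsilon>\<close> the maximum of the perturbed quotient lies in a fixed compact set
  where the gap in \<open>N\<close> is at least \<open>c4\<close>, while the terms with
  \<open>S\<close> are of order \<open>\<epsilon>\<close>; this contradicts the inequality at the
  maximum.\<close>

lemma quot_le_1:
  assumes z0: "z0 \<in> conf" shows "quot \<phi> z0 \<le> 1"
proof (rule ccontr)
  assume "\<not> quot \<phi> z0 \<le> 1"
  then obtain \<delta> where \<delta>: "\<delta> > 1" "\<delta> < quot \<phi> z0" using dense[of 1 "quot \<phi> z0"] by auto
  have M: "M > 0" using f_bounds[of "norm (half z0)"] c_pos confD[OF z0] by auto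
  have "continuous_on (closure \<Omega>) (\<lambda>x. V x - lam)" by (intro continuous_intros V_cont)
  from boundary_supersolution[OF dom this]
  obtain \<eta> q K S where \<eta>: "second_order_on \<Omega> \<eta> q K" "continuous_on (closure \<Omega>) \<eta>" "\<And>x. \<eta> x > 0"
    and S: "continuous_on (closure \<Omega>) S" "\<And>x. x \<in> frontier \<Omega> \<Longrightarrow> S x > 0"
      "\<And>x. x \<in> \<Omega> \<Longrightarrow> S x = (V x - lam) * \<eta> x - lin_trace (K x)" by blast
  obtain C0 where C0: "C0 > 0" "\<And>x. x \<in> closure \<Omega> \<Longrightarrow> \<bar>S x\<bar> \<le> C0"
    using compact_imp_bounded[OF compact_continuous_image[OF S(1) compact_closure_dom]]
    unfolding bounded_pos by (metis imageI real_norm_def)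
  obtain b\<eta> where b\<eta>: "b\<eta> > 0" "\<And>x. x \<in> closure \<Omega> \<Longrightarrow> b\<eta> \<le> \<eta> x"
    using compact_positive_lower_bound[OF compact_closure_dom \<eta>(2)] \<eta>(3) by blast
  have cS: "compact {x \<in> closure \<Omega>. 0 \<le> - S x}"
    by (intro compact_superlevel compact_closure_dom continuous_intros S(1))
  \<comment> \<open>\<open>S > 0\<close> on the frontier, so the compact set where
    \<open>S \<le> 0\<close> lies inside \<open>\<Omega>\<close>, where \<open>\<phi>\<close> is
    positive.\<close>
  obtain c1 where c1: "c1 > 0" "\<And>x. x \<in> closure \<Omega> \<Longrightarrow> S x \<le> 0 \<Longrightarrow> c1 \<le> \<phi> x"
  proof (rule compact_positive_lower_bound[OF cS continuous_on_subset[OF \<phi>_cont]])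
    show "0 < \<phi> x" if "x \<in> {x \<in> closure \<Omega>. 0 \<le> - S x}" for x
      using that S(2)[of x] closure_cases[of x] \<phi>_pos by force
  qed auto
  have cP: "compact {x \<in> closure \<Omega>. - (c1 / 2) \<le> - \<phi> x}"
    by (intro compact_superlevel compact_closure_dom continuous_intros \<phi>_cont)
  \<comment> \<open>By the choice of \<open>c1\<close>, \<open>\<phi> \<le> c1 / 2\<close> forces
    \<open>S > 0\<close>, and compactness makes this uniform.\<close>
  obtain c0 where c0: "c0 > 0" "\<And>x. x \<in> closure \<Omega> \<Longrightarrow> \<phi> x \<le> c1 / 2 \<Longrightarrow> c0 \<le> S x"
  proof (rule compact_positive_lower_bound[OF cP continuous_on_subset[OF S(1)]])
    show "0 < S x" if "x \<in> {x \<in> closure \<Omega>. - (c1 / 2) \<le> - \<phi> x}" for x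
      using that c1(1) c1(2)[of x] by force
  qed auto
  \<comment> \<open>\<open>c2\<close> will bound the perturbed function from below at both inner
    points: either \<open>\<phi> > c1 / 2\<close> there, or balancing the two terms
    \<open>S / u\<close> gives the second value.\<close>
  define c2 where "c2 = min (c1 / 2) (c0 * (c1 / 2) / C0)"
  have c2: "c2 > 0" using c0(1) c1(1) C0(1) by (simp add: c2_def)
  define \<gamma> where "\<gamma> = (c2 * c / M)\<^sup>2"
  have \<gamma>: "\<gamma> > 0" using c2 c_pos M by (simp add: \<gamma>_def)
  \<comment> \<open>A compact set, independent of \<open>\<epsilon>\<close>, that will contain the
    maximiser; on it the positive gap in \<open>N\<close> has the uniform lower bound
    \<open>c4\<close>.\<close>
  define K2 where "K2 = {z \<in> superlevel \<gamma>. \<delta> \<le> quot \<phi> z}"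
  have K2_conf: "K2 \<subseteq> conf" using superlevel_subset_conf[OF \<gamma>] by (auto simp: K2_def)
  have "continuous_on conf (quot \<phi>)" by (rule continuous_on_quot[OF continuous_on_\<phi> \<phi>_pos])
  then have K2: "compact K2" unfolding K2_def
    by (intro compact_superlevel compact_superlevel_outer) (rule continuous_on_subset[OF _ superlevel_subset_conf[OF \<gamma>]])
  have nondeg: "half z \<noteq> 0" "\<bar>tau z\<bar> < 1" "N (norm (half z)) < N (tau z * norm (half z))"
    if "z \<in> conf" "quot \<phi> z > 1" for z
  proof -
    have "\<not> (half z = 0 \<or> \<bar>tau z\<bar> = 1)" using quot_degenerate[OF that(1)] that(2) by auto
    then show 1: "half z \<noteq> 0" "\<bar>tau z\<bar> < 1" using confD(3)[OF that(1)] by linarith+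
    have "\<bar>tau z\<bar> * norm (half z) < 1 * norm (half z)" using 1 by (intro mult_strict_right_mono) auto
    then show "N (norm (half z)) < N (tau z * norm (half z))"
      using confD(6)[OF that(1)] by (intro N_mono) (auto simp: abs_mult)
  qed
  have "continuous_on K2 (\<lambda>z. N (tau z * norm (half z)) - N (norm (half z)))"
  proof (intro continuous_intros continuous_on_compose2[OF N_cont])
    have "tau z * norm (half z) \<in> {-R<..<R} \<and> norm (half z) \<in> {-R<..<R}" if "z \<in> K2" for z
    proof -
      have "z \<in> conf" using that K2_conf by auto
      then have "\<bar>tau z * norm (half z)\<bar> < R" "\<bar>norm (half z)\<bar> < R" using confD(6,8)[of z] by auto
      then show ?thesis unfolding abs_less_iff by auto
    qed
    then show "(\<lambda>z. tau z * norm (half z)) ` K2 \<subseteq> {-R<..<R}" "(\<lambda>z. norm (half z)) ` K2 \<subseteq> {-R<..<R}" by blast+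
  qed
  moreover have "0 < N (tau z * norm (half z)) - N (norm (half z))" if "z \<in> K2" for z
    using nondeg(3)[of z] K2_conf \<delta>(1) that by (auto simp: K2_def)
  ultimately obtain c4 where c4: "c4 > 0" "\<And>z. z \<in> K2 \<Longrightarrow> c4 \<le> N (tau z * norm (half z)) - N (norm (half z))"
    using compact_positive_lower_bound[OF K2] by (metis (no_types, lifting))
  define u where "u = (\<lambda>\<epsilon> x. \<phi> x + \<epsilon> * \<eta> x)"
  have "((\<lambda>\<epsilon>. quot (u \<epsilon>) z0) \<longlongrightarrow> quot (u 0) z0) (at_right 0)"
    unfolding quot_def u_def
    using confD(6)[OF z0] \<phi>_pos[OF confD(4)[OF z0]] \<phi>_pos[OF confD(5)[OF z0]] f_pos[of "norm (half z0)"]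
    by (intro tendsto_intros) auto
  then have "\<forall>\<^sub>F \<epsilon> in at_right 0. \<delta> < quot (u \<epsilon>) z0"
    using \<delta>(2) by (intro order_tendstoD(1)[where y = "quot (u 0) z0"]) (auto simp: u_def)
  \<comment> \<open>This bound on \<open>\<epsilon>\<close> keeps the terms with \<open>S\<close>,
    at worst \<open>- 2 * \<epsilon> * C0 / c2\<close>, above \<open>- 2 * c4\<close>.\<close>
  moreover have "\<forall>\<^sub>F \<epsilon> in at_right 0. \<epsilon> \<in> {0<..<c4 * c2 / C0}"
    using c2 c4(1) C0(1) by (intro eventually_at_right_real) simp
  ultimately have "\<forall>\<^sub>F \<epsilon> in at_right 0. \<delta> < quot (u \<epsilon>) z0 \<and> \<epsilon> \<in> {0<..<c4 * c2 / C0}"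
    by (rule eventually_conj)
  then obtain \<epsilon> where \<epsilon>: "\<delta> < quot (u \<epsilon>) z0" "0 < \<epsilon>" "\<epsilon> < c4 * c2 / C0"
    using eventually_happens'[OF trivial_limit_at_right_real] by (metis (no_types, lifting) greaterThanLessThan_iff)
  have u_ge: "\<epsilon> * b\<eta> \<le> u \<epsilon> x" "0 < \<phi> x" "\<phi> x \<le> u \<epsilon> x" if "x \<in> \<Omega>" for x
  proof -
    have "x \<in> closure \<Omega>" using that closure_subset by auto
    then have "\<epsilon> * b\<eta> \<le> \<epsilon> * \<eta> x" using b\<eta>(2) \<epsilon>(2) by (intro mult_left_mono) auto
    moreover have "0 < \<epsilon> * \<eta> x" using \<eta>(3) \<epsilon>(2) by simp
    ultimately show "\<epsilon> * b\<eta> \<le> u \<epsilon> x" "0 < \<phi> x" "\<phi> x \<le> u \<epsilon> x"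
      using \<phi>_pos[OF that] unfolding u_def by linarith+
  qed
  have u_cont: "continuous_on \<Omega> (u \<epsilon>)" unfolding u_def
    by (intro continuous_intros continuous_on_\<phi> continuous_on_subset[OF \<eta>(2) closure_subset])
  have "\<epsilon> * b\<eta> > 0" "quot (u \<epsilon>) z0 > 1" using \<epsilon>(1,2) b\<eta>(1) \<delta>(1) by auto
  from quot_attains_max[OF u_cont this(1) u_ge(1) z0 this(2)]
  obtain z where z: "z \<in> conf" "quot (u \<epsilon>) z \<ge> quot (u \<epsilon>) z0" "\<And>z'. z' \<in> conf \<Longrightarrow> quot (u \<epsilon>) z' \<le> quot (u \<epsilon>) z"
    by blast
  have qz: "quot (u \<epsilon>) z > \<delta>" using z(2) \<epsilon>(1) by simp
  \<comment> \<open>Returning from \<open>u \<epsilon>\<close> to the smaller \<open>\<phi>\<close>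
    can only raise the quotient, so the maximiser is nondegenerate.\<close>
  have q\<phi>: "quot \<phi> z > \<delta>"
    using quot_antimono[OF z(1), of \<phi> "u \<epsilon>"] u_ge(2,3) qz by force
  have nd: "half z \<noteq> 0" "\<bar>tau z\<bar> < 1" "N (norm (half z)) < N (tau z * norm (half z))"
    using nondeg[OF z(1)] q\<phi> \<delta>(1) by auto
  define U1 U2 where "U1 = u \<epsilon> (inner1 z)" and "U2 = u \<epsilon> (inner2 z)"
  define S1 S2 where "S1 = S (inner1 z)" and "S2 = S (inner2 z)"
  have ineq: "\<epsilon> * (S1 / U1 + S2 / U2) + 2 * (N (tau z * norm (half z)) - N (norm (half z))) \<le> 0"
    unfolding U1_def U2_def S1_def S2_def u_def
    by (rule quot_max_inequality[OF \<eta>(1) \<eta>(3) S(3) \<epsilon>(2) z(1)])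
       (use nd z(3) in \<open>auto simp: u_def\<close>)
  have aux: "a < 0" if "a + 2 * (b - b') \<le> 0" "b' < b" for a b b' :: real using that by simp
  have "\<epsilon> * (S1 / U1 + S2 / U2) < 0" by (rule aux[OF ineq nd(3)])
  then have neg: "S1 / U1 + S2 / U2 < 0" using \<epsilon>(2) by (simp add: mult_less_0_iff)
  have in12: "inner1 z \<in> \<Omega>" "inner2 z \<in> \<Omega>" using confD[OF z(1)] by auto
  txt \<open>Since S is positive near the boundary and is divided by the small number u there, a negative
    sum keeps both inner points away from the boundary.\<close>
  have away: "c2 \<le> u \<epsilon> y" if xy: "x \<in> \<Omega>" "y \<in> \<Omega>" and sum: "S x / u \<epsilon> x + S y / u \<epsilon> y < 0" for x y
  proof (cases "\<phi> y \<le> c1 / 2")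
    case False
    then show ?thesis using u_ge[OF xy(2)] by (auto simp: c2_def)
  next
    case True
    have cl: "x \<in> closure \<Omega>" "y \<in> closure \<Omega>" using xy closure_subset by auto
    have up: "u \<epsilon> x > 0" "u \<epsilon> y > 0" using u_ge[OF xy(1)] u_ge[OF xy(2)] by auto
    have Sy: "c0 \<le> S y" using c0(2)[OF cl(2) True] .
    then have "S y / u \<epsilon> y > 0" using c0(1) up by simp
    then have "S x / u \<epsilon> x < 0" using sum by linarith
    then have "S x < 0" using up by (simp add: divide_less_0_iff)
    then have x1: "c1 / 2 \<le> u \<epsilon> x" using c1(1) c1(2)[OF cl(1)] u_ge[OF xy(1)] by auto
    have "- S x / u \<epsilon> x \<le> C0 / (c1 / 2)"
      using C0(2)[OF cl(1)] \<open>S x < 0\<close> x1 c1(1) by (intro frac_le) auto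
    moreover have "c0 / u \<epsilon> y \<le> S y / u \<epsilon> y" using Sy up by (intro divide_right_mono) auto
    ultimately have "c0 / u \<epsilon> y < C0 / (c1 / 2)" using sum by simp
    then have "c0 * (c1 / 2) / C0 < u \<epsilon> y" using up c1(1) C0(1) by (simp add: field_simps)
    moreover have "c2 \<le> c0 * (c1 / 2) / C0" by (simp add: c2_def)
    ultimately show ?thesis by simp
  qed
  have U: "c2 \<le> U1" "c2 \<le> U2"
    using away[OF in12(2,1)] away[OF in12] neg by (simp_all add: U1_def U2_def S1_def S2_def add.commute)
  have "\<gamma> \<le> outer_prod z"
    unfolding \<gamma>_def by (rule quot_gt_1_outer_prod[of z "u \<epsilon>", OF z(1) _ c2]) (use qz \<delta>(1) U in \<open>auto simp: U1_def U2_def\<close>)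
  then have "z \<in> K2" using conf_superlevel[OF z(1)] q\<phi> by (auto simp: K2_def)
  have S_div: "- (C0 / c2) \<le> S x / u \<epsilon> x" if "x \<in> \<Omega>" "c2 \<le> u \<epsilon> x" for x
  proof -
    have "\<bar>S x\<bar> / u \<epsilon> x \<le> C0 / c2"
      using C0(1) C0(2)[of x] subsetD[OF closure_subset that(1)] that(2) c2 by (intro frac_le) auto
    moreover have "\<bar>S x / u \<epsilon> x\<bar> = \<bar>S x\<bar> / u \<epsilon> x" using that c2 by simp
    ultimately show ?thesis by linarith
  qed
  have "- 2 * (C0 / c2) \<le> S1 / U1 + S2 / U2"
    using S_div[OF in12(1)] S_div[OF in12(2)] U by (simp add: U1_def U2_def S1_def S2_def)
  then have "\<epsilon> * (- 2 * (C0 / c2)) \<le> \<epsilon> * (S1 / U1 + S2 / U2)" using \<epsilon>(2) by (intro mult_left_mono) auto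
  moreover have "\<epsilon> * (- 2 * (C0 / c2)) > - 2 * c4" using \<epsilon>(3) C0(1) c2 by (simp add: field_simps)
  ultimately have "\<epsilon> * (S1 / U1 + S2 / U2) > - 2 * c4" by (rule less_le_trans[rotated])
  then have "0 < \<epsilon> * (S1 / U1 + S2 / U2) + 2 * c4" by simp
  also have "\<dots> \<le> \<epsilon> * (S1 / U1 + S2 / U2) + 2 * (N (tau z * norm (half z)) - N (norm (half z)))"
    using c4(2)[OF \<open>z \<in> K2\<close>] by (intro add_left_mono mult_left_mono) auto
  finally show False using ineq by simp
qed

lemma four_point_inequality:
  assumes "x \<in> \<Omega>" "y \<in> \<Omega>" "\<bar>\<tau>\<bar> \<le> 1"
  defines "m \<equiv> (1/2) *\<^sub>R (x + y)" and "v \<equiv> (1/2) *\<^sub>R (x - y)"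
  shows "\<phi> x * \<phi> y * (f (\<tau> * norm v))\<^sup>2 \<le> \<phi> (m + \<tau> *\<^sub>R v) * \<phi> (m - \<tau> *\<^sub>R v) * (f (norm v))\<^sup>2"
proof -
  define z where "z = (x, y, \<tau>)"
  have z: "z \<in> conf" using assms by (auto simp: z_def conf_def)
  note cz = confD[OF z]
  have "\<phi> (inner1 z) * \<phi> (inner2 z) * (f (norm (half z)))\<^sup>2 > 0"
    using \<phi>_pos[OF cz(4)] \<phi>_pos[OF cz(5)] f_pos[of "norm (half z)"] cz(6) by simp
  then show ?thesis using quot_le_1[OF z]
    by (simp add: quot_def outer_prod_def inner1_def inner2_def mid_def half_def tau_def z_def m_def v_def)
qed

end

section \<open>The modulus of concavity\<close>

text \<open>The points \<open>m + t *\<^sub>R e\<close> and \<open>m - t *\<^sub>R e\<close> are at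
  distance \<open>2 * t\<close>, so the modulus hypothesis says that \<open>k\<close> has
  nonnegative derivative. Comparing \<open>k\<close> at the inner and outer radius gives the claim
  for nonnegative parameters.\<close>

lemma integrated_modulus:
  fixes \<Omega> :: "'a::euclidean_space set"
  assumes cvx: "convex \<Omega>" and V: "\<And>x. x \<in> \<Omega> \<Longrightarrow> V differentiable (at x)"
    and width: "\<And>x y. x \<in> \<Omega> \<Longrightarrow> y \<in> \<Omega> \<Longrightarrow> norm (x - y) / 2 < R"
    and W: "\<And>t. t \<in> {-R..R} \<Longrightarrow> (W has_real_derivative W' t) (at t within {-R..R})"
    and W_even: "\<And>t. t \<in> {-R..R} \<Longrightarrow> W (-t) = W t"
    and modulus: "\<And>x y. x \<in> \<Omega> \<Longrightarrow> y \<in> \<Omega> \<Longrightarrow> x \<noteq> y \<Longrightarrow>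
        (grad V y - grad V x) \<bullet> ((1 / norm (y - x)) *\<^sub>R (y - x)) \<ge> 2 * W' (norm (y - x) / 2)"
    and pts: "m + v \<in> \<Omega>" "m - v \<in> \<Omega>" "\<bar>\<tau>\<bar> \<le> 1"
  shows "2 * W (norm v) - 2 * W (\<tau> * norm v) \<le> V (m + v) + V (m - v) - V (m + \<tau> *\<^sub>R v) - V (m - \<tau> *\<^sub>R v)"
proof -
  have R: "norm v < R"
    using width[OF pts(1,2)] by (simp flip: scaleR_2)
  have pos: "2 * W (norm v) - 2 * W (\<sigma> * norm v) \<le> V (m + v) + V (m - v) - V (m + \<sigma> *\<^sub>R v) - V (m - \<sigma> *\<^sub>R v)"
    if \<sigma>: "0 \<le> \<sigma>" "\<sigma> \<le> 1" for \<sigma>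
  proof (cases "v = 0")
    case False
    define s e where "s = norm v" and "e = (1 / norm v) *\<^sub>R v"
    have s: "s > 0" "s < R" "v = s *\<^sub>R e" "norm e = 1" using False R by (auto simp: s_def e_def)
    have mem: "m + t *\<^sub>R e \<in> \<Omega>" "m - t *\<^sub>R e \<in> \<Omega>" if "0 \<le> t" "t \<le> s" for t
      using convex_inner_points[OF cvx pts(1,2), of "t / s"] that s(1) by (auto simp: e_def s_def)
    define k where "k = (\<lambda>t. V (m + t *\<^sub>R e) + V (m + t *\<^sub>R (- e)) - 2 * W t)"
    have dV: "((\<lambda>t. V (m + t *\<^sub>R b)) has_real_derivative grad V (m + t *\<^sub>R b) \<bullet> b) (at t)" if "m + t *\<^sub>R b \<in> \<Omega>" for t b
      by (intro has_derivative_along_line has_derivative_grad V that)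
    have dk: "(k has_real_derivative (grad V (m + t *\<^sub>R e) \<bullet> e + grad V (m + t *\<^sub>R (-e)) \<bullet> (-e) - 2 * W' t)) (at t within {-R..R})"
      if "0 \<le> t" "t \<le> s" for t
      unfolding k_def using mem[OF that] that s
      by (intro DERIV_add DERIV_diff DERIV_cmult W has_field_derivative_at_within[OF dV]) auto
    have "k (\<sigma> * s) \<le> k s"
    proof (rule DERIV_nonneg_imp_increasing_open[where f = k and a = "\<sigma> * s" and b = s])
      show ss: "\<sigma> * s \<le> s" using \<sigma> s(1) by (simp add: mult_left_le_one_le)
      have s0: "0 \<le> \<sigma> * s" using \<sigma> s(1) by simp
      show "continuous_on {\<sigma> * s..s} k"
        unfolding continuous_on_eq_continuous_within
      proof
        fix t assume t: "t \<in> {\<sigma> * s..s}"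
        have "continuous (at t within {-R..R}) k"
          using dk[of t] t s0 by (auto intro: DERIV_continuous)
        then show "continuous (at t within {\<sigma> * s..s}) k"
          by (rule continuous_within_subset) (use s s0 ss in auto)
      qed
      fix t assume t: "\<sigma> * s < t" "t < s"
      then have t0: "0 < t" "t < R" using s0 s by auto
      have "(k has_real_derivative (grad V (m + t *\<^sub>R e) \<bullet> e + grad V (m + t *\<^sub>R (-e)) \<bullet> (-e) - 2 * W' t)) (at t)"
        using dk[of t] t t0 by (simp add: at_within_Icc_at)
      moreover have "(grad V (m + t *\<^sub>R e) \<bullet> e + grad V (m + t *\<^sub>R (-e)) \<bullet> (-e) - 2 * W' t) \<ge> 0"
      proof -
        have d: "(m + t *\<^sub>R e) - (m - t *\<^sub>R e) = (2 * t) *\<^sub>R e" by (simp add: algebra_simps flip: scaleR_2)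
        have "e \<noteq> 0" using s(4) by auto
        then have "m - t *\<^sub>R e \<noteq> m + t *\<^sub>R e" using d t0 by (metis diff_self mult_pos_pos scaleR_eq_0_iff less_irrefl zero_less_numeral)
        from modulus[OF mem(2) mem(1) this] d t t0 s(4)
        show ?thesis by (simp add: inner_diff_left)
      qed
      ultimately show "\<exists>y. (k has_real_derivative y) (at t) \<and> 0 \<le> y" by blast
    qed
    moreover have "(\<sigma> * s) *\<^sub>R e = \<sigma> *\<^sub>R v" using False by (simp add: e_def s_def)
    ultimately show ?thesis by (simp add: k_def s(3)[symmetric] s_def[symmetric])
  qed simp
  \<comment> \<open>A negative \<open>\<tau>\<close> only swaps the two inner points, and
    \<open>W\<close> is even.\<close>
  show ?thesis
  proof (cases "\<tau> \<ge> 0")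
    case True then show ?thesis using pos[of \<tau>] pts(3) by simp
  next
    case False
    have "\<bar>\<tau> * norm v\<bar> \<le> norm v" using pts(3) by (simp add: abs_mult mult_left_le_one_le)
    then have "W (- (\<tau> * norm v)) = W (\<tau> * norm v)" using R by (intro W_even) (auto simp: abs_le_iff)
    then show ?thesis using False pos[of "-\<tau>"] pts(3) by simp
  qed
qed

text \<open>Pushing \<open>x\<close> slightly away from \<open>y\<close> stays in the open set and
  lengthens the distance. Strictness keeps all radii inside the open interval, where the ground
  state is positive.\<close>

lemma open_diameter_strict:
  fixes S :: "'a::euclidean_space set"
  assumes "open S" "bounded S" "x \<in> S" "y \<in> S"
  shows "norm (x - y) < diameter S"
proof -
  obtain e where e: "e > 0" "ball x e \<subseteq> S" using assms open_contains_ball by blast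
  define w where "w = (if x = y then (SOME b. b \<in> Basis) else (1 / norm (x - y)) *\<^sub>R (x - y))"
  have w: "norm w = 1" "norm (x + (e/2) *\<^sub>R w - y) = norm (x - y) + e / 2"
  proof -
    show n: "norm w = 1" by (auto simp: w_def some_in_eq)
    show "norm (x + (e/2) *\<^sub>R w - y) = norm (x - y) + e / 2"
    proof (cases "x = y")
      case True then show ?thesis using n e by simp
    next
      case False
      then have "x + (e/2) *\<^sub>R w - y = (1 + e / (2 * norm (x - y))) *\<^sub>R (x - y)"
        by (simp add: w_def algebra_simps)
      then have "norm (x + (e/2) *\<^sub>R w - y) = (1 + e / (2 * norm (x - y))) * norm (x - y)"
        using e by (simp only: norm_scaleR) (simp add: add_nonneg_nonneg)
      then show ?thesis using False by (simp add: distrib_right)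
    qed
  qed
  have "x + (e/2) *\<^sub>R w \<in> S" using e w(1) by (intro subsetD[OF e(2)]) (simp add: dist_norm)
  from diameter_bounded_bound[OF assms(2) this assms(4)] w(2) e(1) show ?thesis by (simp add: dist_norm)
qed

section \<open>From the eigenvalue problems to the gradient estimate\<close>

lemma positive_dirichlet_solutionI:
  assumes "R > 0" and eig: "dirichlet_eigenpair {-R<..<R} Vt l \<phi>t" and pos: "\<forall>x\<in>{-R<..<R}. \<phi>t x > 0"
    and Vt: "continuous_on {-R..R} Vt" "\<And>t. t \<in> {-R..R} \<Longrightarrow> Vt (-t) = Vt t"
  shows "positive_dirichlet_solution R l \<phi>t (grad \<phi>t) Vt"
proof
  note e = eig[unfolded dirichlet_eigenpair_def]
  have C2: "C2_on {-R<..<R} \<phi>t" using e by auto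
  note so = second_order_onD[OF C2_on_second_order(1)[OF C2]]
  have cl: "closure {-R<..<R} = {-R..R}" "frontier {-R<..<R} = {-R, R}"
    using \<open>R > 0\<close> by (auto simp: frontier_def interior_open)
  show "R > 0" by fact
  show "continuous_on {-R..R} \<phi>t" "\<phi>t R = 0" "\<phi>t (-R) = 0" using e cl by auto
  show "continuous_on {-R..R} Vt" by fact
  fix t :: real assume "\<bar>t\<bar> < R"
  then have t: "t \<in> {-R<..<R}" by auto
  show "\<phi>t t > 0" using pos t by auto
  show "Vt (-t) = Vt t" using Vt(2)[of t] t by auto
  show "(\<phi>t has_real_derivative grad \<phi>t t) (at t)"
    using so(2)[OF t] by (simp add: has_field_derivative_def inner_real_def)
  define A where "A = frechet_derivative (grad \<phi>t) (at t)"
  have A: "(grad \<phi>t has_derivative A) (at t)" using so(3)[OF t] by (simp add: A_def)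
  \<comment> \<open>On the real line a linear map is multiplication by its value at 1, which is also
    its trace, here the Laplacian.\<close>
  have "A = (*) (A 1)"
  proof
    fix h show "A h = A 1 * h"
      using linear_scale[OF has_derivative_linear[OF A], of h 1] by simp
  qed
  moreover have "A 1 = (Vt t - l) * \<phi>t t"
  proof -
    have "A 1 = lap \<phi>t t" using C2_on_second_order(2)[OF C2 t] by (simp add: A_def lin_trace_def)
    moreover have "- lap \<phi>t t + Vt t * \<phi>t t = l * \<phi>t t" using e t by auto
    ultimately show ?thesis by (simp add: algebra_simps)
  qed
  ultimately show "(grad \<phi>t has_real_derivative (Vt t - l) * \<phi>t t) (at t)"
    using A by (metis has_field_derivative_def)
qed

theorem mainTheorem1:
  fixes \<Omega> :: "'a::euclidean_space set"
    and V :: "'a \<Rightarrow> real"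
    and Vt Vt' \<phi>t :: "real \<Rightarrow> real"
    and \<phi> :: "'a \<Rightarrow> real"
    and d :: real
  assumes dom: "smooth_unif_convex_domain \<Omega>"
    and d_def: "d = diameter \<Omega>"
    and V_smooth: "\<exists>U. open U \<and> closure \<Omega> \<subseteq> U \<and> smooth_on U V"
    and V_convex: "convex_on (closure \<Omega>) V"
    and Vt_deriv: "\<forall>t\<in>{-d/2..d/2}. (Vt has_real_derivative Vt' t) (at t within {-d/2..d/2})"
    and Vt'_cont: "continuous_on {-d/2..d/2} Vt'"
    and Vt_even: "\<forall>t\<in>{-d/2..d/2}. Vt (-t) = Vt t"
    and modulus: "\<forall>x\<in>\<Omega>. \<forall>y\<in>\<Omega>. x \<noteq> y \<longrightarrow>
        (grad V y - grad V x) \<bullet> ((1 / norm (y - x)) *\<^sub>R (y - x)) \<ge> 2 * Vt' (norm (y - x) / 2)"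
    and phi: "first_dirichlet_eigenfunction \<Omega> V \<phi>"
    and phit: "first_dirichlet_eigenfunction {-d/2<..<d/2} Vt \<phi>t"
  shows "\<forall>x\<in>\<Omega>. \<forall>y\<in>\<Omega>. x \<noteq> y \<longrightarrow>
        (grad (\<lambda>z. ln (\<phi> z)) y - grad (\<lambda>z. ln (\<phi> z)) x) \<bullet> ((1 / norm (y - x)) *\<^sub>R (y - x))
          \<le> 2 * deriv (\<lambda>t. ln (\<phi>t t)) (norm (y - x) / 2)"
proof -
  define R where "R = d / 2"
  note opn = smooth_unif_convex_domain_open_convex(1)[OF dom]
    and cvx = smooth_unif_convex_domain_open_convex(2)[OF dom]
  have bnd: "bounded \<Omega>" "\<Omega> \<noteq> {}" using dom by (auto simp: smooth_unif_convex_domain_def)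
  have width: "norm (x - y) / 2 < R" if "x \<in> \<Omega>" "y \<in> \<Omega>" for x y
    using open_diameter_strict[OF opn bnd(1) that] by (simp add: R_def d_def)
  have R: "R > 0" using bnd(2) width by fastforce
  have neg: "- d / 2 = - R" "d / 2 = R" by (simp_all add: R_def)
  obtain lam where lam: "dirichlet_eigenpair \<Omega> V lam \<phi>" and \<phi>_pos: "\<And>x. x \<in> \<Omega> \<Longrightarrow> \<phi> x > 0"
    using phi unfolding first_dirichlet_eigenfunction_def by blast
  obtain l where l: "dirichlet_eigenpair {-R<..<R} Vt l \<phi>t" and \<phi>t_pos: "\<forall>x\<in>{-R<..<R}. \<phi>t x > 0"
    using phit unfolding first_dirichlet_eigenfunction_def neg by blast
  have Vt_cont: "continuous_on {-R..R} Vt"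
    using Vt_deriv unfolding neg by (intro DERIV_continuous_on) auto
  interpret P: positive_dirichlet_solution R l \<phi>t "grad \<phi>t" Vt
    by (rule positive_dirichlet_solutionI[OF R l \<phi>t_pos Vt_cont]) (use Vt_even neg in auto)
  obtain U where U: "closure \<Omega> \<subseteq> U" "smooth_on U V" using V_smooth by blast
  have V_cont: "continuous_on (closure \<Omega>) V" using smooth_onD(2)[OF U(2)] U(1) continuous_on_subset by blast
  have V_diff: "V differentiable (at x)" if "x \<in> \<Omega>" for x
    using smooth_onD(3)[OF U(2)] U(1) that closure_subset by blast
  have V_mod: "2 * Vt (norm v) - 2 * Vt (\<tau> * norm v) \<le> V (m + v) + V (m - v) - V (m + \<tau> *\<^sub>R v) - V (m - \<tau> *\<^sub>R v)"
    if "m + v \<in> \<Omega>" "m - v \<in> \<Omega>" "\<bar>\<tau>\<bar> \<le> 1" for m v \<tau>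
    by (rule integrated_modulus[OF cvx V_diff width _ _ _ that, where W' = Vt'])
       (use Vt_deriv Vt_even modulus neg in auto)
  have C2: "C2_on \<Omega> \<phi>" using lam by (auto simp: dirichlet_eigenpair_def)
  obtain B \<alpha> where corr: "P.is_corrector B \<alpha>" using P.corrector_exists by blast
  have four: "\<phi> x * \<phi> y * (P.perturbed \<alpha> \<kappa> (\<tau> * norm v))\<^sup>2
      \<le> \<phi> (m + \<tau> *\<^sub>R v) * \<phi> (m - \<tau> *\<^sub>R v) * (P.perturbed \<alpha> \<kappa> (norm v))\<^sup>2"
    if \<kappa>: "\<kappa> > 0" and xy: "x \<in> \<Omega>" "y \<in> \<Omega>" "\<bar>\<tau>\<bar> \<le> 1"
      and mv: "m = (1/2) *\<^sub>R (x + y)" "v = (1/2) *\<^sub>R (x - y)" for x y \<tau> \<kappa> m v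
  proof -
    obtain c M where cM: "c > 0" "\<And>t. \<bar>t\<bar> < R \<Longrightarrow> c \<le> P.perturbed \<alpha> \<kappa> t \<and> P.perturbed \<alpha> \<kappa> t \<le> M"
      using P.perturbed_bounds[OF corr \<kappa>] by blast
    \<comment> \<open>\<open>N\<close> is the amount by which \<open>f'' / f\<close> exceeds
      \<open>Vt - l\<close> for the perturbed ground state \<open>f\<close>.\<close>
    define N where "N = (\<lambda>t. \<kappa> / (1 + \<kappa> * \<alpha> t))"
    have den: "1 + \<kappa> * \<alpha> t > 0" if "\<bar>t\<bar> < R" for t
      using P.corrector_nonneg[OF corr that] \<kappa> by (simp add: add_pos_nonneg)
    interpret F: four_point_setting \<Omega> \<phi> V "grad \<phi>" "\<lambda>x. frechet_derivative (grad \<phi>) (at x)" lam R c M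
      "P.perturbed \<alpha> \<kappa>" "P.perturbed1 B \<alpha> \<kappa>" "\<lambda>t. Vt t - l" N
    proof
      show "second_order_on \<Omega> \<phi> (grad \<phi>) (\<lambda>x. frechet_derivative (grad \<phi>) (at x))"
        by (rule C2_on_second_order(1)[OF C2])
      show "lin_trace (frechet_derivative (grad \<phi>) (at x)) = (V x - lam) * \<phi> x" if "x \<in> \<Omega>" for x
      proof -
        have "- lap \<phi> x + V x * \<phi> x = lam * \<phi> x" using lam that by (auto simp: dirichlet_eigenpair_def)
        then show ?thesis using C2_on_second_order(2)[OF C2 that] by (simp add: algebra_simps)
      qed
      show "continuous_on (closure \<Omega>) \<phi>" "\<And>x. x \<in> frontier \<Omega> \<Longrightarrow> \<phi> x = 0"
        using lam by (auto simp: dirichlet_eigenpair_def)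
      show "(P.perturbed1 B \<alpha> \<kappa> has_real_derivative (Vt t - l + N t) * P.perturbed \<alpha> \<kappa> t) (at t)" if "\<bar>t\<bar> < R" for t
      proof -
        have "N t * P.perturbed \<alpha> \<kappa> t = \<kappa> * \<phi>t t"
          using den[OF that] by (simp add: N_def P.perturbed_def[OF corr \<kappa>])
        then show ?thesis using P.perturbed_ode[OF corr \<kappa> that] by (simp add: distrib_right)
      qed
      show "continuous_on {-R<..<R} N"
      proof (intro continuous_at_imp_continuous_on ballI)
        fix t assume "t \<in> {-R<..<R}"
        then have t: "\<bar>t\<bar> < R" by auto
        show "isCont N t" unfolding N_def
          using den[OF t] by (intro continuous_intros DERIV_isCont[OF P.corrD(4)[OF corr t]]) simp
      qed
      show "N t < N s" if "\<bar>s\<bar> < \<bar>t\<bar>" "\<bar>t\<bar> < R" for s t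
        unfolding N_def using P.corrector_strict_mono[OF corr that] den[of s] that \<kappa>
        by (intro divide_strict_left_mono mult_pos_pos den) auto
      show "2 * (Vt (norm v) - l) - 2 * (Vt (\<tau> * norm v) - l)
          \<le> V (m + v) + V (m - v) - V (m + \<tau> *\<^sub>R v) - V (m - \<tau> *\<^sub>R v)"
        if "m + v \<in> \<Omega>" "m - v \<in> \<Omega>" "\<bar>\<tau>\<bar> \<le> 1" for m v \<tau>
        using V_mod[OF that] by simp
    qed (use dom V_cont \<phi>_pos width cM P.perturbed_deriv[OF corr \<kappa>] P.perturbed_even[OF corr \<kappa>] in auto)
    show ?thesis using F.four_point_inequality[OF xy] by (simp add: mv)
  qed
  \<comment> \<open>For fixed points both sides depend continuously on \<open>\<kappa>\<close>, and
    the non-strict inequality survives \<open>\<kappa> \<rightarrow> 0\<close>.\<close>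
  have four0: "\<phi> x * \<phi> y * (\<phi>t (\<tau> * norm v))\<^sup>2 \<le> \<phi> (m + \<tau> *\<^sub>R v) * \<phi> (m - \<tau> *\<^sub>R v) * (\<phi>t (norm v))\<^sup>2"
    if xy: "x \<in> \<Omega>" "y \<in> \<Omega>" "\<bar>\<tau>\<bar> \<le> 1" and mv: "m = (1/2) *\<^sub>R (x + y)" "v = (1/2) *\<^sub>R (x - y)" for x y \<tau> m v
  proof -
    have lim: "((\<lambda>\<kappa>. \<phi>t t * (1 + \<kappa> * \<alpha> t)) \<longlongrightarrow> \<phi>t t * (1 + 0 * \<alpha> t)) (at_right 0)" for t
      by (intro tendsto_intros)
    have "\<phi> x * \<phi> y * (\<phi>t (\<tau> * norm v) * (1 + 0 * \<alpha> (\<tau> * norm v)))\<^sup>2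
       \<le> \<phi> (m + \<tau> *\<^sub>R v) * \<phi> (m - \<tau> *\<^sub>R v) * (\<phi>t (norm v) * (1 + 0 * \<alpha> (norm v)))\<^sup>2"
    proof (rule tendsto_le[OF trivial_limit_at_right_real])
      show "\<forall>\<^sub>F \<kappa> in at_right 0. \<phi> x * \<phi> y * (\<phi>t (\<tau> * norm v) * (1 + \<kappa> * \<alpha> (\<tau> * norm v)))\<^sup>2
       \<le> \<phi> (m + \<tau> *\<^sub>R v) * \<phi> (m - \<tau> *\<^sub>R v) * (\<phi>t (norm v) * (1 + \<kappa> * \<alpha> (norm v)))\<^sup>2"
        using eventually_at_right_less[of 0]
      proof eventually_elim
        case (elim \<kappa>)
        then show ?case using four[OF elim xy mv] by (simp add: P.perturbed_def[OF corr elim])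
      qed
    qed (intro tendsto_intros lim)+
    then show ?thesis by simp
  qed
  have dln: "((\<lambda>z. ln (\<phi> z)) has_derivative (\<lambda>h. grad (\<lambda>z. ln (\<phi> z)) x \<bullet> h)) (at x)" if "x \<in> \<Omega>" for x
    by (rule has_derivative_grad)
       (use second_order_onD(2)[OF second_order_on_ln(1)[OF C2_on_second_order(1)[OF C2] \<phi>_pos]] that
        in \<open>auto simp: differentiable_def\<close>)
  show ?thesis
  proof (intro ballI impI)
    fix x y assume x: "x \<in> \<Omega>" and y: "y \<in> \<Omega>" and "x \<noteq> y"
    define m v s e where "m = (1/2) *\<^sub>R (y + x)" and "v = (1/2) *\<^sub>R (y - x)" and "s = norm v"
      and "e = (1 / norm v) *\<^sub>R v"
    have v: "v \<noteq> 0" "s > 0" "v = s *\<^sub>R e" using \<open>x \<noteq> y\<close> by (auto simp: v_def s_def e_def)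
    have ends: "m + s *\<^sub>R e = y" "m + s *\<^sub>R (- e) = x"
      unfolding scaleR_minus_right v(3)[symmetric]
      by (simp_all add: m_def v_def scaleR_add_right scaleR_diff_right flip: scaleR_add_left)
    have s_eq: "s = norm (y - x) / 2" by (simp add: s_def v_def)
    have e_eq: "(1 / norm (y - x)) *\<^sub>R (y - x) = e" by (simp add: e_def v_def)
    have sR: "\<bar>t\<bar> < R" if "0 < t" "t \<le> s" for t using width[OF y x] that by (simp add: s_eq)
    \<comment> \<open>With the outer points \<open>y\<close> and \<open>x\<close> fixed, the
      four-point inequality says that \<open>g\<close> at \<open>s\<close> is at most
      \<open>g\<close> at slightly smaller radii. So the derivative of \<open>g\<close> at
      \<open>s\<close> is nonpositive, and this derivative is the left side of the claim minus the
      right side.\<close>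
    define g where "g = (\<lambda>t. ln (\<phi> (m + t *\<^sub>R e)) + ln (\<phi> (m + t *\<^sub>R (- e))) - 2 * ln (\<phi>t t))"
    have "((\<lambda>t. ln (\<phi>t t)) has_real_derivative deriv (\<lambda>t. ln (\<phi>t t)) s) (at s)"
    proof (rule DERIV_deriv_iff_real_differentiable[THEN iffD2])
      show "(\<lambda>t. ln (\<phi>t t)) differentiable at s"
        using P.deriv[OF sR] P.pos[OF sR] v(2)
        by (auto simp: real_differentiable_def intro!: exI derivative_eq_intros)
    qed
    then have g: "(g has_real_derivative grad (\<lambda>z. ln (\<phi> z)) y \<bullet> e + grad (\<lambda>z. ln (\<phi> z)) x \<bullet> (- e)
        - 2 * deriv (\<lambda>t. ln (\<phi>t t)) s) (at s)" (is "(g has_real_derivative ?D) (at s)")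
      unfolding g_def using dln[OF x] dln[OF y]
      by (intro DERIV_add DERIV_diff DERIV_cmult has_derivative_along_line) (simp_all add: ends[simplified])
    have "?D \<le> 0"
    proof (rule ccontr)
      assume "\<not> ?D \<le> 0"
      then obtain r where r: "r > 0" "\<And>h. 0 < h \<Longrightarrow> h < r \<Longrightarrow> g (s - h) < g s"
        using DERIV_pos_inc_left[OF g] by auto
      define h where "h = min r s / 2"
      have h: "0 < h" "h < r" "h < s" using r(1) v(2) by (auto simp: h_def)
      define \<tau> where "\<tau> = (s - h) / s"
      have \<tau>: "\<bar>\<tau>\<bar> \<le> 1" "\<tau> * s = s - h" "\<tau> *\<^sub>R v = (s - h) *\<^sub>R e"
        using h v(2) by (auto simp: \<tau>_def v(3))
      have ps: "m + (s - h) *\<^sub>R e \<in> \<Omega>" "m - (s - h) *\<^sub>R e \<in> \<Omega>"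
        using convex_inner_points[OF cvx, of m v \<tau>] ends v(3) x y \<tau> by auto
      have pp: "\<phi> (m + (s - h) *\<^sub>R e) > 0" "\<phi> (m - (s - h) *\<^sub>R e) > 0" "\<phi> x > 0" "\<phi> y > 0"
        "\<phi>t s > 0" "\<phi>t (s - h) > 0"
        using \<phi>_pos ps x y P.pos[OF sR[of s]] P.pos[OF sR[of "s - h"]] h v(2) by auto
      have "\<phi> y * \<phi> x * (\<phi>t (s - h))\<^sup>2 \<le> \<phi> (m + (s - h) *\<^sub>R e) * \<phi> (m - (s - h) *\<^sub>R e) * (\<phi>t s)\<^sup>2"
        using four0[OF y x \<tau>(1) m_def v_def] unfolding s_def[symmetric] \<tau> .
      then have "ln (\<phi> y * \<phi> x * (\<phi>t (s - h))\<^sup>2)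
          \<le> ln (\<phi> (m + (s - h) *\<^sub>R e) * \<phi> (m - (s - h) *\<^sub>R e) * (\<phi>t s)\<^sup>2)"
        using pp by (intro ln_mono) auto
      then have "g s \<le> g (s - h)"
        unfolding g_def ends using pp by (simp add: ln_mult ln_realpow)
      then show False using r(2)[OF h(1,2)] by simp
    qed
    then show "(grad (\<lambda>z. ln (\<phi> z)) y - grad (\<lambda>z. ln (\<phi> z)) x) \<bullet> ((1 / norm (y - x)) *\<^sub>R (y - x))
          \<le> 2 * deriv (\<lambda>t. ln (\<phi>t t)) (norm (y - x) / 2)"
      unfolding e_eq s_eq[symmetric] by (simp add: inner_diff_left)
  qed
qed

end
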